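(* Let $\alpha\in\mathbb{R}$ with $\alpha\neq 0$, and let $\Phi\colon\Sigma\to\mathbb{R}^3$ be a smooth immersion of a connected, oriented surface $\Sigma$ with $0\notin\Phi(\Sigma)$. Suppose that $\Sigma$ is an $\alpha$-stationary surface and that the mean curvature $H$ of $\Sigma$ is constant. Then $\Sigma$ is a plane or a sphere, that is, $\Phi(\Sigma)$ is contained in an affine plane or in a round sphere of $\mathbb{R}^3$.
   Context: For $\alpha\in\mathbb{R}$, the energy of an immersion $\Phi\colon\Sigma\to\mathbb{R}^3$ is $E_\alpha[\Sigma]=\int_\Sigma|\Phi|^\alpha\,d\Sigma$, where $d\Sigma$ is the area element induced on $\Sigma$. Critical points of $E_\alpha$ are called $\alpha$-stationary surfaces (or simply stationary surfaces). When $0\notin\Phi(\Sigma)$, being $\alpha$-stationary is equivalent to the Euler-Lagrange equation $$H=\alpha\,\frac{\langle N,\Phi\rangle}{|\Phi|^2}\quad\text{on }\Sigma,$$ where $N$ is the unit normal (Gauss map) of $\Sigma$, the shape operator is $SX=-\overline{\nabla}_XN$ ($\overline{\nabla}$ the Levi-Civita connection of $\mathbb{R}^3$), $\kappa_1,\kappa_2$ are the principal curvatures (eigenvalues of $S$), and $H=\kappa_1+\kappa_2$ is the mean curvature (sum, not average). Surfaces are not assumed complete or closed, so "a plane or a sphere" is understood as an open piece of one. *)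

theory Defs
  imports "HOL-Analysis.Analysis"
begin

primrec Ck_on :: "nat \<Rightarrow> 'a::euclidean_space set \<Rightarrow> ('a \<Rightarrow> 'b::real_normed_vector) \<Rightarrow> bool" where
  "Ck_on 0 S f \<longleftrightarrow> continuous_on S f"
| "Ck_on (Suc k) S f \<longleftrightarrow> (\<forall>x\<in>S. f differentiable at x) \<and>
     (\<forall>v. Ck_on k S (\<lambda>x. frechet_derivative f (at x) v))"

(* Only used for open S. *)
definition smooth_on :: "'a::euclidean_space set \<Rightarrow> ('a \<Rightarrow> 'b::real_normed_vector) \<Rightarrow> bool" where
  "smooth_on S f \<longleftrightarrow> (\<forall>k. Ck_on k S f)"

(* A surface is a Hausdorff, second countable type 'a together with an atlas of local
   parametrizations (V, x), i.e. x maps the open set V of the plane homeomorphically onto an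
   open subset of 'a (inverse charts). The atlas need not be maximal. *)
type_synonym 'a atlas = "((real^2) set \<times> (real^2 \<Rightarrow> 'a)) set"

definition oriented_atlas :: "'a::{t2_space, second_countable_topology} atlas \<Rightarrow> bool" where
  "oriented_atlas \<A> \<longleftrightarrow>
     (\<forall>(V, x)\<in>\<A>. open V \<and> open (x ` V) \<and> homeomorphism V (x ` V) x (inv_into V x)) \<and>
     (\<Union>(V, x)\<in>\<A>. x ` V) = UNIV \<and>
     (\<forall>(V, x)\<in>\<A>. \<forall>(W, y)\<in>\<A>.
        smooth_on (V \<inter> x -` (y ` W)) (inv_into W y \<circ> x) \<and>
        (\<forall>u\<in>V \<inter> x -` (y ` W). 0 < det (matrix (frechet_derivative (inv_into W y \<circ> x) (at u)))))"

definition smooth_immersion ::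
    "'a::{t2_space, second_countable_topology} atlas \<Rightarrow> ('a \<Rightarrow> real^3) \<Rightarrow> bool" where
  "smooth_immersion \<A> \<Phi> \<longleftrightarrow>
     (\<forall>(V, x)\<in>\<A>. smooth_on V (\<Phi> \<circ> x) \<and> (\<forall>u\<in>V. inj (frechet_derivative (\<Phi> \<circ> x) (at u))))"

(* In what follows, \<Psi> is the immersion read in a local parametrization, \<Psi> = \<Phi> \<circ> x. *)

definition normal_vec :: "(real^2 \<Rightarrow> real^3) \<Rightarrow> real^2 \<Rightarrow> real^3" where
  "normal_vec \<Psi> u = cross3 (frechet_derivative \<Psi> (at u) (axis 1 1))
                          (frechet_derivative \<Psi> (at u) (axis 2 1))"

(* For two parametrizations of an oriented atlas, these normals agree on the overlap. *)
definition unit_normal :: "(real^2 \<Rightarrow> real^3) \<Rightarrow> real^2 \<Rightarrow> real^3" where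
  "unit_normal \<Psi> u = normal_vec \<Psi> u /\<^sub>R norm (normal_vec \<Psi> u)"

definition tangent_plane :: "(real^2 \<Rightarrow> real^3) \<Rightarrow> real^2 \<Rightarrow> (real^3) set" where
  "tangent_plane \<Psi> u = range (frechet_derivative \<Psi> (at u))"

(* The derivative of N along X = d\<Psi>(v) is dN(v); meaningful for X in the tangent plane. *)
definition shape_operator :: "(real^2 \<Rightarrow> real^3) \<Rightarrow> real^2 \<Rightarrow> real^3 \<Rightarrow> real^3" where
  "shape_operator \<Psi> u X =
     - frechet_derivative (unit_normal \<Psi>) (at u) (inv (frechet_derivative \<Psi> (at u)) X)"

(* The eigenvalues of the shape operator, repeated according to multiplicity. *)
definition principal_curvatures :: "(real^2 \<Rightarrow> real^3) \<Rightarrow> real^2 \<Rightarrow> real \<Rightarrow> real \<Rightarrow> bool" where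
  "principal_curvatures \<Psi> u \<kappa>\<^sub>1 \<kappa>\<^sub>2 \<longleftrightarrow>
     (\<exists>X\<in>tangent_plane \<Psi> u. \<exists>Y\<in>tangent_plane \<Psi> u. X \<noteq> Y \<and> independent {X, Y} \<and>
        shape_operator \<Psi> u X = \<kappa>\<^sub>1 *\<^sub>R X \<and> shape_operator \<Psi> u Y = \<kappa>\<^sub>2 *\<^sub>R Y)"

definition mean_curvature :: "(real^2 \<Rightarrow> real^3) \<Rightarrow> real^2 \<Rightarrow> real" where
  "mean_curvature \<Psi> u = (THE H. \<exists>\<kappa>\<^sub>1 \<kappa>\<^sub>2. principal_curvatures \<Psi> u \<kappa>\<^sub>1 \<kappa>\<^sub>2 \<and> H = \<kappa>\<^sub>1 + \<kappa>\<^sub>2)"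

definition constant_mean_curvature ::
    "'a::{t2_space, second_countable_topology} atlas \<Rightarrow> ('a \<Rightarrow> real^3) \<Rightarrow> bool" where
  "constant_mean_curvature \<A> \<Phi> \<longleftrightarrow>
     (\<exists>c. \<forall>(V, x)\<in>\<A>. \<forall>u\<in>V. mean_curvature (\<Phi> \<circ> x) u = c)"

(* \<mu> is the area measure of the immersion: the unique Borel measure that is given by the area
   element |\<Psi>_u \<times> \<Psi>_v| du dv in every parametrization of the atlas. *)
definition is_area_measure ::
    "'a::{t2_space, second_countable_topology} atlas \<Rightarrow> ('a \<Rightarrow> real^3) \<Rightarrow> 'a measure \<Rightarrow> bool" where
  "is_area_measure \<A> \<Phi> \<mu> \<longleftrightarrow> sets \<mu> = sets borel \<and>
     (\<forall>(V, x)\<in>\<A>. \<forall>B\<in>sets borel. B \<subseteq> V \<longrightarrow>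
        emeasure \<mu> (x ` B) = (\<integral>\<^sup>+u\<in>B. ennreal (norm (normal_vec (\<Phi> \<circ> x) u)) \<partial>lborel))"

(* E is the energy of the part K of the surface; a relation, in the style of has_integral. *)
definition has_energy ::
    "'a::{t2_space, second_countable_topology} atlas \<Rightarrow> real \<Rightarrow> 'a set \<Rightarrow> ('a \<Rightarrow> real^3) \<Rightarrow> real \<Rightarrow> bool" where
  "has_energy \<A> \<alpha> K \<Phi> E \<longleftrightarrow>
     (\<exists>\<mu>. is_area_measure \<A> \<Phi> \<mu> \<and> E = (LINT p:K|\<mu>. norm (\<Phi> p) powr \<alpha>))"

(* A smooth variation F t (|t| < e) of \<Phi> through immersions, supported in the compact set K. *)
definition compact_variation ::
    "'a::{t2_space, second_countable_topology} atlas \<Rightarrow> ('a \<Rightarrow> real^3) \<Rightarrow> 'a set \<Rightarrow> real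
       \<Rightarrow> (real \<Rightarrow> 'a \<Rightarrow> real^3) \<Rightarrow> bool" where
  "compact_variation \<A> \<Phi> K e F \<longleftrightarrow> compact K \<and> 0 < e \<and> F 0 = \<Phi> \<and>
     (\<forall>(V, x)\<in>\<A>. smooth_on ({-e<..<e} \<times> V) (\<lambda>(t, u). F t (x u))) \<and>
     (\<forall>t\<in>{-e<..<e}. smooth_immersion \<A> (F t) \<and> (\<forall>p. p \<notin> K \<longrightarrow> F t p = \<Phi> p))"

(* Critical points of the energy. The integral over the whole surface may diverge, so, as usual,
   only the energy of the compact support K of the variation, the part that can change, is
   differentiated. Notation: E t is the energy of F t on K. *)
definition stationary ::
    "'a::{t2_space, second_countable_topology} atlas \<Rightarrow> real \<Rightarrow> ('a \<Rightarrow> real^3) \<Rightarrow> bool" where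
  "stationary \<A> \<alpha> \<Phi> \<longleftrightarrow>
     (\<forall>K e F. compact_variation \<A> \<Phi> K e F \<longrightarrow>
        (\<exists>E. (\<forall>t\<in>{-e<..<e}. has_energy \<A> \<alpha> K (F t) (E t)) \<and>
             (E has_real_derivative 0) (at 0)))"

end

theory Submission
  imports Defs
begin

text \<open>
  A constant mean curvature surface that is critical for \<open>E\<^sub>\<alpha>\<close> satisfies two pointwise conditions:
  its mean curvature is a constant \<open>c\<close>, and \<open>c * (\<Phi> \<bullet> \<Phi>) = \<alpha> * h\<close>, where \<open>h = \<Phi> \<bullet> N\<close> is the
  support function. The second is the Euler-Lagrange equation. It is extracted from the first
  variation (\<open>first_variation\<close>, \<open>euler_lagrange\<close>): near a point the surface is moved by \<open>t * \<phi>\<close> in the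
  fixed direction of the normal at that point, with \<open>\<phi>\<close> a bump function in a chart, and the resulting
  integral identity is localized by integration by parts.

  Let \<open>P = \<Phi> - h *\<^sub>R N\<close> be the tangential part of the position vector. Differentiating
  \<open>c * (\<Phi> \<bullet> \<Phi>) = \<alpha> * h\<close> shows that \<open>P\<close> is a principal direction with the constant curvature
  \<open>- 2 * c / \<alpha>\<close> wherever it does not vanish (\<open>principal_frame\<close>). The mean curvature is constant, so
  the other principal curvature \<open>\<kappa>\<^sub>2 = c + 2 * c / \<alpha>\<close> is constant as well; their difference is
  \<open>k = c + 4 * c / \<alpha>\<close>.

  If \<open>k \<noteq> 0\<close>, the symmetry of the second derivatives of \<open>N + \<kappa>\<^sub>2 *\<^sub>R \<Phi>\<close> (in the role of the
  Codazzi equations) forces \<open>1 + h * \<kappa>\<^sub>2 = 0\<close> where \<open>P \<noteq> 0\<close> (\<open>support_times_curvature\<close>). Then \<open>h\<close>, and with it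
  \<open>\<Phi> \<bullet> \<Phi>\<close>, is locally constant there, which contradicts \<open>P \<noteq> 0\<close>. Hence \<open>P = 0\<close> everywhere
  (\<open>position_normal\<close>), and the surface lies on a sphere about the origin.

  If \<open>k = 0\<close>, the surface is umbilic: \<open>N + \<kappa>\<^sub>2 *\<^sub>R \<Phi>\<close> has derivative zero (\<open>umbilic\<close>), so it is
  constant on the connected surface. For \<open>c = 0\<close> this makes the normal constant, and \<open>h = 0\<close> puts
  the surface into a plane through the origin; for \<open>c \<noteq> 0\<close> it puts the surface on a sphere of radius
  \<open>2 / \<bar>c\<bar>\<close>.
\<close>

section \<open>Smooth maps\<close>

text \<open>
  The direction precedes the point, so that \<open>\<partial> f v\<close> is again a map on the domain of \<open>f\<close> and can be
  differentiated further.
\<close>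
abbreviation dir_deriv :: "('a::real_normed_vector \<Rightarrow> 'b::real_normed_vector) \<Rightarrow> 'a \<Rightarrow> 'a \<Rightarrow> 'b"
    ("\<partial>") where
  "\<partial> \<equiv> \<lambda>f v u. frechet_derivative f (at u) v"

lemma dir_deriv_eqI: "(f has_derivative f') (at u) \<Longrightarrow> \<partial> f v u = f' v"
  by (simp add: frechet_derivative_at[symmetric])

lemma Ck_on_differentiable: "Ck_on (Suc k) S f \<Longrightarrow> x \<in> S \<Longrightarrow> f differentiable at x"
  by simp

lemma Ck_on_has_derivative:
  "Ck_on (Suc k) S f \<Longrightarrow> x \<in> S \<Longrightarrow> (f has_derivative (\<lambda>v. \<partial> f v x)) (at x)"
  by (simp add: frechet_derivative_works[symmetric])

lemma Ck_on_SucI: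
  assumes "\<And>x. x \<in> S \<Longrightarrow> (f has_derivative f' x) (at x)"
    and "\<And>v. Ck_on k S (\<lambda>x. frechet_derivative f (at x) v)"
  shows "Ck_on (Suc k) S f"
  using assms by (auto simp: differentiable_def)

lemma Ck_on_cong:
  assumes "open S" "\<And>x. x \<in> S \<Longrightarrow> f x = g x" "Ck_on k S f"
  shows "Ck_on k S g"
  using assms(2,3)
proof (induction k arbitrary: f g)
  case 0
  then show ?case using continuous_on_cong[of S S f g] by simp
next
  case (Suc k)
  have *: "(g has_derivative (\<lambda>v. \<partial> f v x)) (at x)" if "x \<in> S" for x
    using Ck_on_has_derivative[OF Suc.prems(2) that] assms(1) that Suc.prems(1)
    by (rule has_derivative_transform_within_open)
  show ?case
  proof (rule Ck_on_SucI[OF *])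
    fix v
    show "Ck_on k S (\<partial> g v)"
      by (rule Suc.IH[of "\<partial> f v"]) (use Suc.prems(2) in \<open>simp_all add: dir_deriv_eqI[OF *]\<close>)
  qed
qed

lemma Ck_on_SucI':
  assumes "open S" "\<And>x. x \<in> S \<Longrightarrow> (f has_derivative f' x) (at x)"
    and "\<And>v. Ck_on k S (\<lambda>x. f' x v)"
  shows "Ck_on (Suc k) S f"
proof (rule Ck_on_SucI[OF assms(2)])
  show "Ck_on k S (\<partial> f v)" for v
    using assms(1) _ assms(3)[of v] by (rule Ck_on_cong) (simp add: dir_deriv_eqI[OF assms(2)])
qed

lemma Ck_on_subset: "Ck_on k T f \<Longrightarrow> S \<subseteq> T \<Longrightarrow> Ck_on k S f"
  by (induction k arbitrary: f) (auto intro: continuous_on_subset)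

lemma Ck_on_Un: "open S \<Longrightarrow> open T \<Longrightarrow> Ck_on k S f \<Longrightarrow> Ck_on k T f \<Longrightarrow> Ck_on k (S \<union> T) f"
  by (induction k arbitrary: f) (auto intro: continuous_on_open_Un)

lemma Ck_on_Suc_imp: "open S \<Longrightarrow> Ck_on (Suc k) S f \<Longrightarrow> Ck_on k S f"
proof (induction k arbitrary: f)
  case 0
  then show ?case
    by (auto intro!: continuous_at_imp_continuous_on differentiable_imp_continuous_within)
qed auto

lemma Ck_on_const [simp]: "Ck_on k S (\<lambda>x. c)"
  by (induction k arbitrary: c) simp_all

lemma Ck_on_add:
  assumes "open S"
  shows "Ck_on k S f \<Longrightarrow> Ck_on k S g \<Longrightarrow> Ck_on k S (\<lambda>x. f x + g x)"
proof (induction k arbitrary: f g)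
  case 0
  then show ?case by (auto intro: continuous_on_add)
next
  case (Suc k)
  then show ?case
    by (intro Ck_on_SucI'[OF assms has_derivative_add[OF Ck_on_has_derivative Ck_on_has_derivative]])
       auto
qed

lemma (in bounded_bilinear) Ck_on_bilinear:
  assumes "open S"
  shows "Ck_on k S f \<Longrightarrow> Ck_on k S g \<Longrightarrow> Ck_on k S (\<lambda>x. prod (f x) (g x))"
proof (induction k arbitrary: f g)
  case 0
  then show ?case by (auto intro: continuous_on)
next
  case (Suc k)
  have fg: "Ck_on k S f" "Ck_on k S g"
    using Suc.prems by (blast intro: Ck_on_Suc_imp[OF assms])+
  show ?case
  proof (rule Ck_on_SucI'[OF assms FDERIV[OF Ck_on_has_derivative Ck_on_has_derivative]])
    fix v
    show "Ck_on k S (\<lambda>x. prod (f x) (\<partial> g v x) + prod (\<partial> f v x) (g x))"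
      using Suc.prems fg by (intro Ck_on_add[OF assms] Suc.IH) auto
  qed (use Suc.prems in auto)
qed

lemma Ck_on_bounded_linear:
  assumes "bounded_linear L" "open S"
  shows "Ck_on k S f \<Longrightarrow> Ck_on k S (\<lambda>x. L (f x))"
proof (induction k arbitrary: f)
  case 0
  then show ?case
    using linear_continuous_on[OF assms(1)] by (auto intro: continuous_on_compose2)
next
  case (Suc k)
  then show ?case
    by (intro Ck_on_SucI'[OF assms(2) bounded_linear.has_derivative[OF assms(1) Ck_on_has_derivative]])
       auto
qed

lemma Ck_on_linear_map: "bounded_linear L \<Longrightarrow> Ck_on k S L"
proof (cases k)
  case 0
  then show "bounded_linear L \<Longrightarrow> Ck_on k S L" by (simp add: linear_continuous_on)
next
  case (Suc j)
  assume L: "bounded_linear L"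
  show "Ck_on k S L" unfolding Suc
  proof (rule Ck_on_SucI[OF bounded_linear_imp_has_derivative[OF L]])
    show "Ck_on j S (\<partial> L v)" for v
      by (simp add: dir_deriv_eqI[OF bounded_linear_imp_has_derivative[OF L]])
  qed
qed

lemma Ck_on_sum:
  assumes "open S"
  shows "(\<And>i. i \<in> I \<Longrightarrow> Ck_on k S (f i)) \<Longrightarrow> Ck_on k S (\<lambda>x. \<Sum>i\<in>I. f i x)"
  by (induction I rule: infinite_finite_induct) (auto intro: Ck_on_add[OF assms])

text \<open>
  The chain rule expresses a directional derivative of \<open>g \<circ> f\<close> as a sum of products of components
  of a derivative of \<open>f\<close> with partial derivatives of \<open>g\<close> composed with \<open>f\<close>; the latter fall under
  the induction hypothesis.
\<close>
lemma Ck_on_compose: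
  fixes f :: "'a::euclidean_space \<Rightarrow> 'b::euclidean_space"
    and g :: "'b \<Rightarrow> 'c::real_normed_vector"
  assumes "open S" "open T" "f ` S \<subseteq> T"
  shows "Ck_on k S f \<Longrightarrow> Ck_on k T g \<Longrightarrow> Ck_on k S (\<lambda>x. g (f x))"
proof (induction k arbitrary: g)
  case 0
  then show ?case using assms(3) by (auto intro: continuous_on_compose2)
next
  case (Suc k)
  have g: "(g has_derivative (\<lambda>w. \<partial> g w (f x))) (at (f x))" if "x \<in> S" for x
    using Ck_on_has_derivative[OF Suc.prems(2)] assms(3) that by auto
  have "((\<lambda>x. g (f x)) has_derivative (\<lambda>v. \<Sum>b\<in>Basis. (\<partial> f v x \<bullet> b) *\<^sub>R \<partial> g b (f x))) (at x)"
    if x: "x \<in> S" for x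
  proof -
    interpret G: bounded_linear "\<lambda>w. \<partial> g w (f x)"
      by (rule has_derivative_bounded_linear[OF g[OF x]])
    have "(\<Sum>b\<in>Basis. (\<partial> f v x \<bullet> b) *\<^sub>R \<partial> g b (f x)) = \<partial> g (\<partial> f v x) (f x)" for v
      using arg_cong[OF euclidean_representation[of "\<partial> f v x"], of "\<lambda>w. \<partial> g w (f x)"]
      by (simp add: G.sum G.scaleR del: euclidean_representation)
    then show ?thesis
      using has_derivative_compose[OF Ck_on_has_derivative[OF Suc.prems(1) x] g[OF x]] by simp
  qed
  moreover have "Ck_on k S (\<lambda>x. \<Sum>b\<in>Basis. (\<partial> f v x \<bullet> b) *\<^sub>R \<partial> g b (f x))" for v
  proof (intro Ck_on_sum assms(1) bounded_bilinear.Ck_on_bilinear[OF bounded_bilinear_scaleR])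
    fix b :: 'b assume "b \<in> Basis"
    show "Ck_on k S (\<lambda>x. \<partial> f v x \<bullet> b)"
      using Suc.prems(1) by (intro Ck_on_bounded_linear[OF bounded_linear_inner_left] assms) auto
    show "Ck_on k S (\<lambda>x. \<partial> g b (f x))"
      by (rule Suc.IH[of "\<partial> g b"]) (use Suc.prems Ck_on_Suc_imp[OF assms(1)] in auto)
  qed
  ultimately show ?case by (rule Ck_on_SucI'[OF assms(1)])
qed

lemma smooth_on_cong:
  "open S \<Longrightarrow> (\<And>x. x \<in> S \<Longrightarrow> f x = g x) \<Longrightarrow> smooth_on S f \<Longrightarrow> smooth_on S g"
  unfolding smooth_on_def using Ck_on_cong[of S f g] by blast

lemma smooth_on_subset: "smooth_on T f \<Longrightarrow> S \<subseteq> T \<Longrightarrow> smooth_on S f"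
  unfolding smooth_on_def using Ck_on_subset by blast

lemma smooth_on_Un: "open S \<Longrightarrow> open T \<Longrightarrow> smooth_on S f \<Longrightarrow> smooth_on T f \<Longrightarrow> smooth_on (S \<union> T) f"
  unfolding smooth_on_def using Ck_on_Un by blast

lemma smooth_on_const [simp]: "smooth_on S (\<lambda>x. c)"
  by (simp add: smooth_on_def)

lemma smooth_on_Un_zero:
  assumes "open T" "open Z" "smooth_on T g" "\<And>u. u \<in> Z \<Longrightarrow> g u = 0"
  shows "smooth_on (T \<union> Z) g"
proof -
  have "smooth_on Z g"
    by (rule smooth_on_cong[OF assms(2) _ smooth_on_const[of Z 0]]) (simp add: assms(4))
  then show ?thesis by (rule smooth_on_Un[OF assms(1-3)])
qed

lemma smooth_on_linear: "bounded_linear L \<Longrightarrow> smooth_on S L"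
  by (simp add: smooth_on_def Ck_on_linear_map)

lemma smooth_on_add: "open S \<Longrightarrow> smooth_on S f \<Longrightarrow> smooth_on S g \<Longrightarrow> smooth_on S (\<lambda>x. f x + g x)"
  by (simp add: smooth_on_def Ck_on_add)

lemma (in bounded_bilinear) smooth_on_bilinear:
  "open S \<Longrightarrow> smooth_on S f \<Longrightarrow> smooth_on S g \<Longrightarrow> smooth_on S (\<lambda>x. prod (f x) (g x))"
  by (simp add: smooth_on_def Ck_on_bilinear)

lemmas smooth_on_scaleR = bounded_bilinear.smooth_on_bilinear[OF bounded_bilinear_scaleR]
lemmas smooth_on_mult = bounded_bilinear.smooth_on_bilinear[OF bounded_bilinear_mult]
lemmas smooth_on_inner = bounded_bilinear.smooth_on_bilinear[OF bounded_bilinear_inner]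

lemma bounded_bilinear_cross3: "bounded_bilinear cross3"
  using bilinear_cross by (simp add: bilinear_conv_bounded_bilinear)

lemmas smooth_on_cross3 = bounded_bilinear.smooth_on_bilinear[OF bounded_bilinear_cross3]

lemma smooth_on_diff:
  assumes "open S" "smooth_on S f" "smooth_on S g"
  shows "smooth_on S (\<lambda>x. f x - g x)"
  using smooth_on_add[OF assms(1,2) smooth_on_scaleR[OF assms(1) smooth_on_const[of S "-1::real"] assms(3)]]
  by simp

lemma smooth_on_compose:
  fixes f :: "'a::euclidean_space \<Rightarrow> 'b::euclidean_space"
  assumes "open S" "open T" "f ` S \<subseteq> T" "smooth_on S f" "smooth_on T g"
  shows "smooth_on S (\<lambda>x. g (f x))"
  using assms unfolding smooth_on_def by (blast intro: Ck_on_compose)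

lemma smooth_on_has_derivative:
  "smooth_on S f \<Longrightarrow> x \<in> S \<Longrightarrow> (f has_derivative (\<lambda>v. \<partial> f v x)) (at x)"
  unfolding smooth_on_def using Ck_on_has_derivative by blast

lemma smooth_on_differentiable: "smooth_on S f \<Longrightarrow> x \<in> S \<Longrightarrow> f differentiable at x"
  unfolding smooth_on_def using Ck_on_differentiable by blast

lemma smooth_on_dir_deriv: "smooth_on S f \<Longrightarrow> smooth_on S (\<partial> f v)"
  unfolding smooth_on_def by (metis Ck_on.simps(2))

lemma smooth_on_imp_continuous_on: "smooth_on S f \<Longrightarrow> continuous_on S f"
  unfolding smooth_on_def by (metis Ck_on.simps(1))

text \<open>
  The factor \<open>c\<close> makes the family closed under differentiation, as the induction requires.
\<close>
lemma Ck_on_powr: "Ck_on k {0<..} (\<lambda>s::real. c * s powr a)"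
proof (induction k arbitrary: a c)
  case 0
  then show ?case by (auto intro!: continuous_intros)
next
  case (Suc k)
  show ?case
  proof (rule Ck_on_SucI')
    fix x :: real assume "x \<in> {0<..}"
    then have "((\<lambda>s. c * s powr a) has_real_derivative c * (a * x powr (a - 1))) (at x)"
      by (auto intro!: derivative_eq_intros simp: powr_diff)
    then show "((\<lambda>s. c * s powr a) has_derivative (\<lambda>v. c * (a * x powr (a - 1)) * v)) (at x)"
      by (simp add: has_field_derivative_def)
  next
    fix v
    show "Ck_on k {0<..} (\<lambda>x. c * (a * x powr (a - 1)) * v)"
      using Suc.IH[of "c * a * v" "a - 1"] by (simp add: mult_ac)
  qed simp
qed

lemma smooth_on_powr:
  assumes "open S" "smooth_on S f" "\<And>x. x \<in> S \<Longrightarrow> f x > 0"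
  shows "smooth_on S (\<lambda>x. f x powr a :: real)"
  using smooth_on_compose[OF assms(1), of "{0<..}" f "\<lambda>s. s powr a"] assms Ck_on_powr[of _ 1 a]
  by (auto simp: smooth_on_def)

lemma smooth_on_norm_powr:
  fixes f :: "'a::euclidean_space \<Rightarrow> 'b::euclidean_space"
  assumes "open S" "smooth_on S f" "\<And>x. x \<in> S \<Longrightarrow> f x \<noteq> 0"
  shows "smooth_on S (\<lambda>x. norm (f x) powr a)"
proof -
  have "smooth_on S (\<lambda>x. (f x \<bullet> f x) powr (a / 2))"
    using assms by (intro smooth_on_powr smooth_on_inner) auto
  moreover have "(f x \<bullet> f x) powr (a / 2) = norm (f x) powr a" for x
    by (simp add: norm_eq_sqrt_inner powr_half_sqrt[symmetric] powr_powr)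
  ultimately show ?thesis by simp
qed

section \<open>Symmetry of second derivatives\<close>

lemma has_real_derivative_along_line:
  fixes f :: "'a::real_normed_vector \<Rightarrow> real"
  assumes "f differentiable at (p + s *\<^sub>R v)"
  shows "((\<lambda>s. f (p + s *\<^sub>R v)) has_real_derivative \<partial> f v (p + s *\<^sub>R v)) (at s)"
proof -
  let ?D = "\<lambda>v. \<partial> f v (p + s *\<^sub>R v)"
  have D: "(f has_derivative frechet_derivative f (at (p + s *\<^sub>R v))) (at (p + s *\<^sub>R v))"
    using assms by (simp add: frechet_derivative_works)
  have "((\<lambda>s. p + s *\<^sub>R v) has_derivative (\<lambda>t. t *\<^sub>R v)) (at s)"
    by (auto intro!: derivative_eq_intros)
  from has_derivative_compose[OF this D]
  have "((\<lambda>s. f (p + s *\<^sub>R v)) has_derivative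
      (\<lambda>t. frechet_derivative f (at (p + s *\<^sub>R v)) (t *\<^sub>R v))) (at s)" .
  then show ?thesis
    by (simp add: has_field_derivative_def mult_commute_abs
        linear_scale[OF linear_frechet_derivative[OF assms]])
qed

text \<open>Two applications of the mean value theorem, first along \<open>v\<close> and then along \<open>w\<close>.\<close>
lemma second_difference_mean_value:
  fixes f :: "'a::euclidean_space \<Rightarrow> real"
  assumes f: "Ck_on 2 S f" and "convex S" and h: "0 < h"
    and S: "u \<in> S" "u + h *\<^sub>R v \<in> S" "u + h *\<^sub>R w \<in> S" "u + h *\<^sub>R v + h *\<^sub>R w \<in> S"
  obtains z where "z \<in> S"
    "f (u + h *\<^sub>R v + h *\<^sub>R w) - f (u + h *\<^sub>R v) - f (u + h *\<^sub>R w) + f u = h\<^sup>2 * \<partial> (\<partial> f v) w z"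
proof -
  have line: "p + t *\<^sub>R x \<in> S" if "p \<in> S" "p + h *\<^sub>R x \<in> S" "0 \<le> t" "t \<le> h" for p x t
  proof -
    have "p + t *\<^sub>R x = (1 - t / h) *\<^sub>R p + (t / h) *\<^sub>R (p + h *\<^sub>R x)"
      using h by (simp add: algebra_simps)
    then show ?thesis
      using convexD[OF \<open>convex S\<close> that(1,2), of "1 - t / h" "t / h"] that h by simp
  qed
  have f': "f differentiable at z" and f'': "\<partial> f v differentiable at z" if "z \<in> S" for z
    using f that by (auto simp: numeral_2_eq_2)
  have eq: "u + h *\<^sub>R w + s *\<^sub>R v = u + s *\<^sub>R v + h *\<^sub>R w" for s by simp
  have "((\<lambda>s. f (u + h *\<^sub>R w + s *\<^sub>R v) - f (u + s *\<^sub>R v)) has_real_derivative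
      \<partial> f v (u + h *\<^sub>R w + s *\<^sub>R v) - \<partial> f v (u + s *\<^sub>R v)) (at s)" if "0 \<le> s" "s \<le> h" for s
    using line[of u v s] line[of "u + h *\<^sub>R w" v s] that S
    by (intro DERIV_diff has_real_derivative_along_line f') (simp_all add: add_ac)
  from MVT2[OF h this] obtain s where s: "0 < s" "s < h" and 1:
    "(f (u + h *\<^sub>R w + h *\<^sub>R v) - f (u + h *\<^sub>R v)) - (f (u + h *\<^sub>R w) - f u)
      = h * (\<partial> f v (u + s *\<^sub>R v + h *\<^sub>R w) - \<partial> f v (u + s *\<^sub>R v))"
    unfolding eq by auto
  have "((\<lambda>t. \<partial> f v (u + s *\<^sub>R v + t *\<^sub>R w)) has_real_derivative
      \<partial> (\<partial> f v) w (u + s *\<^sub>R v + t *\<^sub>R w)) (at t)" if "0 \<le> t" "t \<le> h" for t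
    using line[of "u + s *\<^sub>R v" w t] line[of u v s] line[of "u + h *\<^sub>R w" v s] that S s
    by (intro has_real_derivative_along_line f'') (simp_all add: add_ac)
  from MVT2[OF h this] obtain t where t: "0 < t" "t < h" and 2:
    "\<partial> f v (u + s *\<^sub>R v + h *\<^sub>R w) - \<partial> f v (u + s *\<^sub>R v)
      = h * \<partial> (\<partial> f v) w (u + s *\<^sub>R v + t *\<^sub>R w)"
    by auto
  show thesis
  proof (rule that)
    show "u + s *\<^sub>R v + t *\<^sub>R w \<in> S"
      using line[of "u + s *\<^sub>R v" w t] line[of u v s] line[of "u + h *\<^sub>R w" v s] S s t
      by (simp add: add_ac)
    show "f (u + h *\<^sub>R v + h *\<^sub>R w) - f (u + h *\<^sub>R v) - f (u + h *\<^sub>R w) + f u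
      = h\<^sup>2 * \<partial> (\<partial> f v) w (u + s *\<^sub>R v + t *\<^sub>R w)"
      using 1 2 by (simp add: power2_eq_square add_ac)
  qed
qed

text \<open>
  The second difference is symmetric in \<open>v\<close> and \<open>w\<close>. Divided by \<open>h\<^sup>2\<close>, it is a value of either
  mixed derivative at a point within distance \<open>d\<close> of \<open>u\<close>, so the two are equal by continuity.
\<close>
lemma dir_deriv_commute_real:
  fixes f :: "'a::euclidean_space \<Rightarrow> real"
  assumes "open S" "Ck_on 2 S f" "u \<in> S"
  shows "\<partial> (\<partial> f v) w u = \<partial> (\<partial> f w) v u"
proof -
  have cont: "((\<partial> (\<partial> f x) y) \<longlongrightarrow> \<partial> (\<partial> f x) y u) (nhds u)" for x y
    using assms
    by (subst tendsto_at_iff_tendsto_nhds[symmetric])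
       (auto simp: numeral_2_eq_2 continuous_on_eq_continuous_at isCont_def)
  have "\<bar>\<partial> (\<partial> f v) w u - \<partial> (\<partial> f w) v u\<bar> \<le> e" if e: "0 < e" for e
  proof -
    have "\<forall>\<^sub>F z in nhds u. z \<in> S \<and> dist (\<partial> (\<partial> f v) w z) (\<partial> (\<partial> f v) w u) < e / 2 \<and>
        dist (\<partial> (\<partial> f w) v z) (\<partial> (\<partial> f w) v u) < e / 2"
      using cont[of v w] cont[of w v] e assms
      by (intro eventually_conj eventually_nhds_in_open tendstoD) auto
    then obtain d where d: "d > 0" "\<And>z. dist z u < d \<Longrightarrow> z \<in> S"
      "\<And>z. dist z u < d \<Longrightarrow> dist (\<partial> (\<partial> f v) w z) (\<partial> (\<partial> f v) w u) < e / 2"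
      "\<And>z. dist z u < d \<Longrightarrow> dist (\<partial> (\<partial> f w) v z) (\<partial> (\<partial> f w) v u) < e / 2"
      unfolding eventually_nhds_metric by blast
    define h where "h = d / (1 + norm v + norm w)"
    have pos: "0 < 1 + norm v + norm w" by (simp add: add_pos_nonneg)
    have h: "0 < h" using d pos by (simp add: h_def)
    have "h * (1 + norm v + norm w) = d" using pos by (simp add: h_def)
    then have hd: "h * norm v + h * norm w = d - h" by (simp add: algebra_simps)
    have nn: "0 \<le> h * norm v" "0 \<le> h * norm w" using h by simp_all
    have *: "norm (h *\<^sub>R v + h *\<^sub>R w) < d"
      using norm_triangle_ineq[of "h *\<^sub>R v" "h *\<^sub>R w"] hd h by simp
    have ball: "u + x \<in> ball u d" if "norm x < d" for x
      using that by (simp add: dist_norm)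
    have in_ball: "u \<in> ball u d" "u + h *\<^sub>R v \<in> ball u d" "u + h *\<^sub>R w \<in> ball u d"
      "u + h *\<^sub>R v + h *\<^sub>R w \<in> ball u d" "u + h *\<^sub>R w + h *\<^sub>R v \<in> ball u d"
      using ball[of "h *\<^sub>R v"] ball[of "h *\<^sub>R w"] ball[OF *] hd nn h d
      by (simp_all add: add_ac)
    have f: "Ck_on 2 (ball u d) f"
      using d by (intro Ck_on_subset[OF assms(2)]) (auto simp: dist_commute)
    obtain y where y: "y \<in> ball u d"
      "f (u + h *\<^sub>R v + h *\<^sub>R w) - f (u + h *\<^sub>R v) - f (u + h *\<^sub>R w) + f u = h\<^sup>2 * \<partial> (\<partial> f v) w y"
      using second_difference_mean_value[OF f convex_ball h] in_ball by metis
    obtain z where z: "z \<in> ball u d"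
      "f (u + h *\<^sub>R w + h *\<^sub>R v) - f (u + h *\<^sub>R w) - f (u + h *\<^sub>R v) + f u = h\<^sup>2 * \<partial> (\<partial> f w) v z"
      using second_difference_mean_value[OF f convex_ball h] in_ball by metis
    have "h\<^sup>2 * \<partial> (\<partial> f v) w y = h\<^sup>2 * \<partial> (\<partial> f w) v z"
      using y(2) z(2) by (simp add: algebra_simps)
    then have "\<partial> (\<partial> f v) w y = \<partial> (\<partial> f w) v z" using h by simp
    moreover have "dist (\<partial> (\<partial> f v) w y) (\<partial> (\<partial> f v) w u) < e / 2"
      "dist (\<partial> (\<partial> f w) v z) (\<partial> (\<partial> f w) v u) < e / 2"
      using d(3)[of y] d(4)[of z] y(1) z(1) by (auto simp: dist_commute)
    ultimately show ?thesis unfolding dist_real_def by linarith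
  qed
  then show ?thesis
    by (metis abs_le_zero_iff dense_ge eq_iff_diff_eq_0)
qed

lemma dir_deriv_bounded_linear:
  assumes "bounded_linear L" "f differentiable at u"
  shows "\<partial> (\<lambda>x. L (f x)) v u = L (\<partial> f v u)"
  using bounded_linear.has_derivative[OF assms(1)] assms(2)
  by (intro dir_deriv_eqI) (auto simp: frechet_derivative_works)

theorem dir_deriv_commute:
  fixes f :: "'a::euclidean_space \<Rightarrow> 'b::euclidean_space"
  assumes "open S" "smooth_on S f" "u \<in> S"
  shows "\<partial> (\<partial> f v) w u = \<partial> (\<partial> f w) v u"
proof (rule euclidean_eqI)
  fix b :: 'b assume "b \<in> Basis"
  note L = bounded_linear_inner_left[of b]
  have comp: "\<partial> (\<partial> (\<lambda>x. f x \<bullet> b) x) y u = \<partial> (\<partial> f x) y u \<bullet> b" for x y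
  proof -
    have 1: "\<partial> (\<lambda>x. f x \<bullet> b) x z = \<partial> f x z \<bullet> b" if "z \<in> S" for z
      by (rule dir_deriv_bounded_linear[OF L smooth_on_differentiable[OF assms(2) that]])
    have "\<partial> (\<lambda>x. f x \<bullet> b) x differentiable at u"
      by (rule smooth_on_differentiable[OF smooth_on_dir_deriv[OF
            smooth_on_inner[OF assms(1,2) smooth_on_const]] assms(3)])
    then have "\<partial> (\<partial> (\<lambda>x. f x \<bullet> b) x) y u = \<partial> (\<lambda>z. \<partial> f x z \<bullet> b) y u"
      using frechet_derivative_transform_within_open[OF _ assms(1,3) 1] by simp
    also have "\<dots> = \<partial> (\<partial> f x) y u \<bullet> b"
      by (rule dir_deriv_bounded_linear[OF L
            smooth_on_differentiable[OF smooth_on_dir_deriv[OF assms(2)] assms(3)]])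
    finally show ?thesis .
  qed
  have "smooth_on S (\<lambda>x. f x \<bullet> b)"
    by (rule smooth_on_inner[OF assms(1,2) smooth_on_const])
  then have "\<partial> (\<partial> (\<lambda>x. f x \<bullet> b) v) w u = \<partial> (\<partial> (\<lambda>x. f x \<bullet> b) w) v u"
    by (intro dir_deriv_commute_real[OF assms(1) _ assms(3)]) (simp add: smooth_on_def)
  then show "\<partial> (\<partial> f v) w u \<bullet> b = \<partial> (\<partial> f w) v u \<bullet> b"
    unfolding comp .
qed

section \<open>Bump functions\<close>

text \<open>
  The derivatives of \<open>exp (- 1 / s)\<close>, extended by zero to the negative half-line, are linear
  combinations of these functions.
\<close>
definition flat_exp :: "nat \<Rightarrow> real \<Rightarrow> real" where
  "flat_exp k s = (if s > 0 then inverse s ^ k * exp (- inverse s) else 0)"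

lemma flat_exp_tendsto_0: "(flat_exp k \<longlongrightarrow> 0) (at 0)"
proof (rule filterlim_split_at)
  show "(flat_exp k \<longlongrightarrow> 0) (at_left 0)"
    by (rule tendsto_eventually) (auto simp: flat_exp_def eventually_at_filter)
  have "((\<lambda>s. inverse s ^ k / exp (inverse s)) \<longlongrightarrow> 0) (at_right (0::real))"
    by (rule filterlim_compose[OF tendsto_power_div_exp_0 filterlim_inverse_at_top_right])
  moreover have "\<forall>\<^sub>F s in at_right 0. inverse s ^ k / exp (inverse s) = flat_exp k s"
    by (auto simp: flat_exp_def eventually_at_filter exp_minus divide_simps)
  ultimately show "(flat_exp k \<longlongrightarrow> 0) (at_right 0)"
    by (rule Lim_transform_eventually)
qed

lemma flat_exp_deriv:
  "(flat_exp k has_real_derivative (flat_exp (k + 2) s - k * flat_exp (k + 1) s)) (at s)"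
proof (cases s "0::real" rule: linorder_cases)
  case less
  have "((\<lambda>s. 0) has_real_derivative 0) (at s)" by simp
  then have "(flat_exp k has_real_derivative 0) (at s)"
    by (rule has_field_derivative_transform_within_open[where S = "{..<0}"])
       (use less in \<open>auto simp: flat_exp_def\<close>)
  then show ?thesis using less by (simp add: flat_exp_def)
next
  case equal
  have "(\<lambda>h. (flat_exp k (0 + h) - flat_exp k 0) / h) = flat_exp (Suc k)"
    by (auto simp: flat_exp_def divide_simps)
  then show ?thesis
    using flat_exp_tendsto_0[of "Suc k"] by (simp add: DERIV_def equal) (simp add: flat_exp_def)
next
  case greater
  have "((\<lambda>s. inverse s ^ k * exp (- inverse s)) has_real_derivative
      inverse s ^ k * (exp (- inverse s) * (inverse s * inverse s)) -
      (k * inverse s ^ (k - 1) * inverse s) * inverse s * exp (- inverse s)) (at s)"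
    using greater by (auto intro!: derivative_eq_intros)
  moreover have "k * inverse s ^ (k - 1) * inverse s = k * inverse s ^ k"
    by (cases k) auto
  ultimately have "((\<lambda>s. inverse s ^ k * exp (- inverse s)) has_real_derivative
      inverse s ^ k * (exp (- inverse s) * (inverse s * inverse s)) -
      (k * inverse s ^ k) * inverse s * exp (- inverse s)) (at s)"
    by (simp only:)
  then have "((\<lambda>s. inverse s ^ k * exp (- inverse s)) has_real_derivative
      flat_exp (k + 2) s - k * flat_exp (k + 1) s) (at s)"
    using greater by (simp add: flat_exp_def mult_ac)
  then show ?thesis
    by (rule has_field_derivative_transform_within_open[where S = "{0<..}"])
       (use greater in \<open>auto simp: flat_exp_def\<close>)
qed

lemma Ck_on_flat_exp: "Ck_on j UNIV (\<lambda>s. c * flat_exp k s)"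
proof (induction j arbitrary: c k)
  case 0
  then show ?case
    by (auto intro!: continuous_intros DERIV_isCont[OF flat_exp_deriv]
        continuous_at_imp_continuous_on)
next
  case (Suc j)
  have "((\<lambda>s. c * flat_exp k s) has_derivative
      (\<lambda>v. v * (c * (flat_exp (k + 2) s - k * flat_exp (k + 1) s)))) (at s)" for s
    using DERIV_cmult[OF flat_exp_deriv, of c k s] by (simp add: has_field_derivative_def mult_commute_abs)
  moreover have "Ck_on j UNIV (\<lambda>s. v * (c * (flat_exp (k + 2) s - k * flat_exp (k + 1) s)))" for v
    using Ck_on_add[OF open_UNIV Suc.IH[of "v * c" "k + 2"] Suc.IH[of "- (v * c * k)" "k + 1"]]
    by (simp add: algebra_simps)
  ultimately show ?case
    by (intro Ck_on_SucI'[OF open_UNIV]) auto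
qed

definition bump :: "'a::euclidean_space \<Rightarrow> real \<Rightarrow> 'a \<Rightarrow> real" where
  "bump a r u = flat_exp 0 (r\<^sup>2 - (u - a) \<bullet> (u - a))"

lemma smooth_on_bump: "smooth_on UNIV (bump a r)"
proof -
  have 1: "smooth_on UNIV (\<lambda>u. u - a)"
    by (rule smooth_on_diff[OF open_UNIV smooth_on_linear[OF bounded_linear_ident] smooth_on_const])
  have 2: "smooth_on UNIV (\<lambda>u. r\<^sup>2 - (u - a) \<bullet> (u - a))"
    by (rule smooth_on_diff[OF open_UNIV smooth_on_const smooth_on_inner[OF open_UNIV 1 1]])
  have 3: "smooth_on UNIV (flat_exp 0)"
    using Ck_on_flat_exp[of _ 1 0] by (simp add: smooth_on_def)
  show ?thesis
    unfolding bump_def by (rule smooth_on_compose[OF open_UNIV open_UNIV subset_UNIV 2 3])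
qed

lemma bump_pos_iff: "r > 0 \<Longrightarrow> bump a r u > 0 \<longleftrightarrow> u \<in> ball a r"
proof -
  assume r: "r > 0"
  have "norm (u - a) < r \<longleftrightarrow> (norm (u - a))\<^sup>2 < r\<^sup>2"
    using r power_strict_mono[of "norm (u - a)" r 2] power2_less_imp_less[of "norm (u - a)" r] by auto
  then show ?thesis
    by (simp add: bump_def flat_exp_def dist_norm norm_minus_commute dot_square_norm)
qed

lemma bump_nonneg: "bump a r u \<ge> 0"
  by (simp add: bump_def flat_exp_def)

lemma bump_eq_0: "r > 0 \<Longrightarrow> u \<notin> ball a r \<Longrightarrow> bump a r u = 0"
  using bump_pos_iff bump_nonneg by (metis less_eq_real_def)

section \<open>Integration by parts\<close>

text \<open>
  Translating the domain does not change the integral of a compactly supported function;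
  differentiating this with respect to the translation parameter under the integral sign shows that
  its directional derivatives integrate to zero.
\<close>
lemma integral_dir_deriv_compact_support:
  fixes g :: "'a::euclidean_space \<Rightarrow> real"
  assumes diff: "\<And>u. g differentiable at u" and cont: "continuous_on UNIV (\<partial> g v)"
    and supp: "\<And>u. g u \<noteq> 0 \<Longrightarrow> cball u \<delta> \<subseteq> cbox p q" and \<delta>: "\<delta> > 0"
  shows "integral (cbox p q) (\<partial> g v) = 0"
proof -
  define \<tau> where "\<tau> = \<delta> / (1 + norm v)"
  have pos: "1 + norm v > 0" by (simp add: add_pos_nonneg)
  have \<tau>: "\<tau> > 0" using \<delta> pos by (simp add: \<tau>_def)
  define I where "I t = integral (cbox p q) (\<lambda>u. g (u + t *\<^sub>R v))" for t
  have g_cont: "continuous_on UNIV g"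
    using diff by (auto intro!: continuous_at_imp_continuous_on differentiable_imp_continuous_within)
  have all: "integral S g = integral UNIV g" if "\<And>u. g u \<noteq> 0 \<Longrightarrow> u \<in> S" for S
  proof -
    have "(\<lambda>u. if u \<in> S then g u else 0) = g" by (rule ext) (use that in auto)
    then show ?thesis using integral_restrict_UNIV[of S g] by simp
  qed
  have I_const: "I t = integral UNIV g" if t: "t \<in> cball 0 \<tau>" for t
  proof -
    have "\<bar>t\<bar> * (1 + norm v) \<le> \<delta>"
      using t pos by (simp add: \<tau>_def field_simps)
    then have tv: "norm (t *\<^sub>R v) \<le> \<delta>"
      by (simp add: algebra_simps)
    have "I t = integral (cbox (p + t *\<^sub>R v) (q + t *\<^sub>R v)) g"
      unfolding I_def using integral_shift_cbox[of "p + t *\<^sub>R v" "t *\<^sub>R v" "q + t *\<^sub>R v" g] by simp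
    also have "\<dots> = integral UNIV g"
    proof (rule all)
      fix u assume "g u \<noteq> 0"
      then have "u - t *\<^sub>R v \<in> cbox p q"
        using supp[of u] tv by (auto simp: dist_norm)
      then show "u \<in> cbox (p + t *\<^sub>R v) (q + t *\<^sub>R v)"
        by (auto simp: mem_box algebra_simps)
    qed
    finally show ?thesis .
  qed
  have deriv: "((\<lambda>t. g (u + t *\<^sub>R v)) has_real_derivative \<partial> g v (u + t *\<^sub>R v)) (at t within cball 0 \<tau>)"
    for u t
    by (rule DERIV_subset[OF has_real_derivative_along_line[OF diff] subset_UNIV])
  have "(I has_real_derivative integral (cbox p q) (\<lambda>u. \<partial> g v (u + 0 *\<^sub>R v))) (at 0 within cball 0 \<tau>)"
    unfolding I_def
  proof (rule leibniz_rule_field_derivative[OF deriv])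
    show "(\<lambda>u. g (u + t *\<^sub>R v)) integrable_on cbox p q" for t
      by (intro integrable_continuous continuous_on_compose2[OF g_cont] continuous_intros) auto
    show "continuous_on (cball 0 \<tau> \<times> cbox p q) (\<lambda>(t, u). \<partial> g v (u + t *\<^sub>R v))"
      unfolding split_beta
      by (intro continuous_on_compose2[OF cont] continuous_intros) auto
  qed (use \<tau> in auto)
  moreover have "(I has_real_derivative 0) (at 0 within cball 0 \<tau>)"
    by (rule has_field_derivative_transform_within[OF DERIV_const[of "integral UNIV g"] \<tau>])
       (use I_const \<tau> in auto)
  moreover have "at 0 within cball 0 \<tau> = at (0::real)"
    by (rule at_within_interior) (use \<tau> in auto)
  ultimately show ?thesis
    using DERIV_unique[of I _ 0] by simp
qed

section \<open>Rules for directional derivatives\<close>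

lemma dir_deriv_bilinear:
  assumes "bounded_bilinear b" "f differentiable at u" "g differentiable at u"
  shows "\<partial> (\<lambda>x. b (f x) (g x)) v u = b (f u) (\<partial> g v u) + b (\<partial> f v u) (g u)"
  using assms(2,3)
  by (intro dir_deriv_eqI bounded_bilinear.FDERIV[OF assms(1)]) (auto simp: frechet_derivative_works)

lemmas dir_deriv_inner = dir_deriv_bilinear[OF bounded_bilinear_inner]
lemmas dir_deriv_cross3 = dir_deriv_bilinear[OF bounded_bilinear_cross3]
lemmas dir_deriv_scaleR = dir_deriv_bilinear[OF bounded_bilinear_scaleR]
lemmas dir_deriv_mult = dir_deriv_bilinear[OF bounded_bilinear_mult]

lemma dir_deriv_diff:
  assumes "f differentiable at u" "g differentiable at u"
  shows "\<partial> (\<lambda>x. f x - g x) v u = \<partial> f v u - \<partial> g v u"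
  using assms by (intro dir_deriv_eqI has_derivative_diff) (auto simp: frechet_derivative_works)

lemma dir_deriv_add:
  assumes "f differentiable at u" "g differentiable at u"
  shows "\<partial> (\<lambda>x. f x + g x) v u = \<partial> f v u + \<partial> g v u"
  using assms by (intro dir_deriv_eqI has_derivative_add) (auto simp: frechet_derivative_works)

lemma dir_deriv_cong:
  assumes "open S" "u \<in> S" "\<And>x. x \<in> S \<Longrightarrow> f x = g x" "f differentiable at u"
  shows "\<partial> f v u = \<partial> g v u"
  using frechet_derivative_transform_within_open[OF assms(4,1,2,3)] by simp

lemma dir_deriv_locally_const:
  assumes "open S" "u \<in> S" "\<And>x. x \<in> S \<Longrightarrow> f x = c"
  shows "\<partial> f v u = 0"
proof -
  have "(f has_derivative (\<lambda>v. 0)) (at u)"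
    by (rule has_derivative_transform_within_open[OF has_derivative_const[of c] assms(1,2)])
       (simp add: assms(3))
  then show ?thesis by (rule dir_deriv_eqI)
qed

section \<open>Linear algebra in the plane and in space\<close>

lemma real2_expand: "v = v $ 1 *\<^sub>R axis 1 1 + v $ 2 *\<^sub>R axis 2 (1::real)" for v :: "real^2"
  by (simp add: vec_eq_iff forall_2 axis_def)

lemma linear_real2_expand:
  fixes D :: "real^2 \<Rightarrow> 'b::real_vector"
  assumes "linear D"
  shows "D v = v $ 1 *\<^sub>R D (axis 1 1) + v $ 2 *\<^sub>R D (axis 2 1)"
  using arg_cong[OF real2_expand[of v], of D] linear_add[OF assms] linear_scale[OF assms] by simp

lemmas cross3_bilinear = cross_add_left cross_add_right cross_mult_left cross_mult_right

text \<open>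
  An alternating bilinear map on the plane is a multiple of the determinant.
\<close>
lemma cross3_linear_images:
  fixes D M :: "real^2 \<Rightarrow> real^3"
  assumes "linear D" "linear M"
  shows "cross3 (M v) (D w) + cross3 (D v) (M w) = (v $ 1 * w $ 2 - v $ 2 * w $ 1) *\<^sub>R
    (cross3 (M (axis 1 1)) (D (axis 2 1)) + cross3 (D (axis 1 1)) (M (axis 2 1)))"
  unfolding linear_real2_expand[OF assms(1), of v] linear_real2_expand[OF assms(1), of w]
    linear_real2_expand[OF assms(2), of v] linear_real2_expand[OF assms(2), of w]
    cross3_bilinear
  using cross_skew[of "D (axis 1 1)" "M (axis 1 1)"] cross_skew[of "D (axis 2 1)" "M (axis 2 1)"]
    cross_skew[of "D (axis 2 1)" "M (axis 1 1)"] cross_skew[of "M (axis 2 1)" "D (axis 1 1)"]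
  by (simp add: algebra_simps)

lemma cross3_linear_image:
  fixes D :: "real^2 \<Rightarrow> real^3"
  assumes "linear D"
  shows "cross3 (D v) (D w) = (v $ 1 * w $ 2 - v $ 2 * w $ 1) *\<^sub>R cross3 (D (axis 1 1)) (D (axis 2 1))"
  unfolding linear_real2_expand[OF assms, of v] linear_real2_expand[OF assms, of w] cross3_bilinear
  using cross_skew[of "D (axis 2 1)" "D (axis 1 1)"]
  by (simp add: algebra_simps)

text \<open>Cramer's rule for the coordinates of \<open>X\<close> in the frame \<open>a\<close>, \<open>b\<close>, \<open>cross3 a b\<close>.\<close>
lemma cross3_frame_expand:
  "(cross3 a b \<bullet> cross3 a b) *\<^sub>R X = (cross3 X b \<bullet> cross3 a b) *\<^sub>R a + (cross3 a X \<bullet> cross3 a b) *\<^sub>R b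
    + (X \<bullet> cross3 a b) *\<^sub>R cross3 a b"
  unfolding vec_eq_iff forall_3
  by (simp add: cross_components inner_vec_def sum_3; algebra)

lemma independent_pair_iff_cross3: "X \<noteq> Y \<and> independent {X, Y} \<longleftrightarrow> cross3 X Y \<noteq> 0"
proof -
  have "X \<noteq> Y \<and> independent {X, Y} \<longleftrightarrow> X \<notin> span {Y} \<and> Y \<noteq> 0"
    by (cases "X = Y") (auto simp: independent_insert span_base)
  moreover have "cross3 X Y = 0 \<longleftrightarrow> cross3 Y X = 0"
    using cross_skew[of X Y] by simp
  moreover have "cross3 Y X = 0 \<longleftrightarrow> X \<in> span {Y} \<or> Y = 0"
    unfolding cross_eq_0 collinear_lemma span_singleton by (auto intro: exI[of _ 0])
  ultimately show ?thesis by blast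
qed

lemma inner_cross3_swap: "a \<bullet> cross3 z b = - (z \<bullet> cross3 a b)" "a \<bullet> cross3 b z = - (z \<bullet> cross3 b a)"
  by (simp_all add: cross3_simps)

lemma inj_linear_real2_iff:
  fixes D :: "real^2 \<Rightarrow> real^3"
  assumes "linear D"
  shows "inj D \<longleftrightarrow> cross3 (D (axis 1 1)) (D (axis 2 1)) \<noteq> 0"
proof
  assume n: "cross3 (D (axis 1 1)) (D (axis 2 1)) \<noteq> 0"
  show "inj D"
  proof (subst linear_injective_0[OF assms], intro allI impI)
    fix v assume "D v = 0"
    then have 0: "v $ 1 *\<^sub>R D (axis 1 1) + v $ 2 *\<^sub>R D (axis 2 1) = 0"
      using linear_real2_expand[OF assms, of v] by simp
    from arg_cong[OF 0, of "\<lambda>X. cross3 X (D (axis 2 1))"] arg_cong[OF 0, of "\<lambda>X. cross3 (D (axis 1 1)) X"]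
    show "v = 0" using n by (auto simp: cross3_bilinear vec_eq_iff forall_2)
  qed
next
  assume inj: "inj D"
  show "cross3 (D (axis 1 1)) (D (axis 2 1)) \<noteq> 0"
  proof
    assume "cross3 (D (axis 1 1)) (D (axis 2 1)) = 0"
    then consider "D (axis 1 1) = 0" | "D (axis 2 1) = 0"
      | c where "D (axis 2 1) = c *\<^sub>R D (axis 1 1)"
      unfolding cross_eq_0 collinear_lemma by blast
    then obtain a b :: real where "a \<noteq> 0 \<or> b \<noteq> 0"
      and "a *\<^sub>R D (axis 1 1) + b *\<^sub>R D (axis 2 1) = 0"
    proof cases
      case 1
      then show ?thesis using that[of 1 0] by simp
    next
      case 2
      then show ?thesis using that[of 0 1] by simp
    next
      case (3 c)
      then show ?thesis using that[of c "-1"] by simp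
    qed
    moreover have "D (a *\<^sub>R axis 1 1 + b *\<^sub>R axis 2 1)
        = a *\<^sub>R D (axis 1 1) + b *\<^sub>R D (axis 2 1)"
      using assms by (simp add: linear_add linear_scale)
    ultimately have "a *\<^sub>R axis 1 1 + b *\<^sub>R axis 2 1 = (0 :: real^2)"
      using injD[OF inj] linear_0[OF assms] by metis
    then show False
      using \<open>a \<noteq> 0 \<or> b \<noteq> 0\<close> by (auto simp: vec_eq_iff forall_2 axis_def)
  qed
qed

section \<open>Immersed patches\<close>

locale immersed_patch =
  fixes V :: "(real^2) set" and \<Psi> :: "real^2 \<Rightarrow> real^3"
  assumes open_V: "open V"
    and smooth: "smooth_on V \<Psi>"
    and inj_deriv: "u \<in> V \<Longrightarrow> inj (frechet_derivative \<Psi> (at u))"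
begin

abbreviation N :: "real^2 \<Rightarrow> real^3" where "N \<equiv> unit_normal \<Psi>"

lemma linear_deriv: "u \<in> V \<Longrightarrow> linear (\<lambda>v. \<partial> \<Psi> v u)"
  using linear_frechet_derivative[OF smooth_on_differentiable[OF smooth]] by simp

lemma normal_vec_nonzero:
  assumes u: "u \<in> V"
  shows "normal_vec \<Psi> u \<noteq> 0"
  using inj_linear_real2_iff[OF linear_deriv[OF u]] inj_deriv[OF u] by (simp add: normal_vec_def)

lemma smooth_normal_vec: "smooth_on V (normal_vec \<Psi>)"
  unfolding normal_vec_def
  by (rule smooth_on_cross3[OF open_V smooth_on_dir_deriv[OF smooth] smooth_on_dir_deriv[OF smooth]])

lemma smooth_N: "smooth_on V N"
proof -
  have "smooth_on V (\<lambda>u. norm (normal_vec \<Psi> u) powr (-1) *\<^sub>R normal_vec \<Psi> u)"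
    by (rule smooth_on_scaleR[OF open_V
          smooth_on_norm_powr[OF open_V smooth_normal_vec normal_vec_nonzero] smooth_normal_vec])
  then show ?thesis
    by (rule smooth_on_cong[OF open_V, rotated])
       (simp add: unit_normal_def powr_minus normal_vec_nonzero)
qed

lemma differentiable: "u \<in> V \<Longrightarrow> \<Psi> differentiable at u"
  and differentiable_N: "u \<in> V \<Longrightarrow> N differentiable at u"
  and differentiable_deriv: "u \<in> V \<Longrightarrow> \<partial> \<Psi> v differentiable at u"
  using smooth smooth_N smooth_on_dir_deriv[OF smooth] by (blast intro: smooth_on_differentiable)+

lemma linear_dN: "u \<in> V \<Longrightarrow> linear (\<lambda>v. \<partial> N v u)"
  using linear_frechet_derivative[OF differentiable_N] by simp

lemma normal_vec_eq: "u \<in> V \<Longrightarrow> normal_vec \<Psi> u = norm (normal_vec \<Psi> u) *\<^sub>R N u"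
  by (simp add: unit_normal_def normal_vec_nonzero)

lemma inner_N_N: "u \<in> V \<Longrightarrow> N u \<bullet> N u = 1"
  by (simp add: unit_normal_def normal_vec_nonzero dot_square_norm power2_eq_square)

lemma inner_deriv_N: assumes "u \<in> V" shows "\<partial> \<Psi> v u \<bullet> N u = 0"
  unfolding linear_real2_expand[OF linear_deriv[OF assms], of v]
  by (simp add: unit_normal_def normal_vec_def inner_add_left dot_cross_self)

lemma inner_dN_N: assumes "u \<in> V" shows "\<partial> N v u \<bullet> N u = 0"
proof -
  have "\<partial> (\<lambda>x. N x \<bullet> N x) v u = 0"
    by (rule dir_deriv_locally_const[OF open_V assms inner_N_N])
  then show ?thesis
    using dir_deriv_inner[OF differentiable_N differentiable_N, OF assms assms, of v]
    by (simp add: inner_commute)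
qed

lemma tangent_iff:
  assumes u: "u \<in> V"
  shows "(\<exists>v. X = \<partial> \<Psi> v u) \<longleftrightarrow> X \<bullet> N u = 0"
proof
  assume "X \<bullet> N u = 0"
  then have "X \<bullet> normal_vec \<Psi> u = 0"
    by (subst normal_vec_eq[OF u]) simp
  then obtain a b where "(normal_vec \<Psi> u \<bullet> normal_vec \<Psi> u) *\<^sub>R X
      = a *\<^sub>R \<partial> \<Psi> (axis 1 1) u + b *\<^sub>R \<partial> \<Psi> (axis 2 1) u"
    unfolding normal_vec_def by (metis cross3_frame_expand add.right_neutral scaleR_zero_left)
  also have "\<dots> = \<partial> \<Psi> (a *\<^sub>R axis 1 1 + b *\<^sub>R axis 2 1) u"
    using linear_deriv[OF u] by (simp add: linear_add linear_scale)
  finally have "X = inverse (normal_vec \<Psi> u \<bullet> normal_vec \<Psi> u) *\<^sub>R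
      \<partial> \<Psi> (a *\<^sub>R axis 1 1 + b *\<^sub>R axis 2 1) u"
    using normal_vec_nonzero[OF u] by (metis inner_eq_zero_iff left_inverse scaleR_one scaleR_scaleR)
  then show "\<exists>v. X = \<partial> \<Psi> v u"
    using linear_scale[OF linear_deriv[OF u]] by metis
qed (use inner_deriv_N[OF u] in auto)

text \<open>
  Differentiating \<open>\<partial> \<Psi> v \<bullet> N = 0\<close> gives the second fundamental form
  \<open>- \<partial> \<Psi> v \<bullet> \<partial> N w = \<partial> (\<partial> \<Psi> v) w \<bullet> N\<close>, which inherits its symmetry from the second derivatives.
\<close>
lemma dN_symmetric:
  assumes u: "u \<in> V"
  shows "\<partial> N v u \<bullet> \<partial> \<Psi> w u = \<partial> N w u \<bullet> \<partial> \<Psi> v u"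
proof -
  have "\<partial> (\<partial> \<Psi> v) w u \<bullet> N u = - (\<partial> \<Psi> v u \<bullet> \<partial> N w u)" for v w
  proof -
    have "\<partial> (\<lambda>x. \<partial> \<Psi> v x \<bullet> N x) w u = 0"
      by (rule dir_deriv_locally_const[OF open_V u inner_deriv_N])
    then show ?thesis
      using dir_deriv_inner[OF differentiable_deriv differentiable_N, OF u u, of v w] by simp
  qed
  from this[of v w] this[of w v] show ?thesis
    using dir_deriv_commute[OF open_V smooth u, of v w] by (simp add: inner_commute)
qed

lemma shape_operator_deriv:
  assumes "u \<in> V"
  shows "shape_operator \<Psi> u (\<partial> \<Psi> v u) = - \<partial> N v u"
  by (simp add: shape_operator_def inv_f_f[OF inj_deriv[OF assms]])

text \<open>
  Both sides are alternating and bilinear in \<open>v\<close> and \<open>w\<close>, so it suffices to compare them on a pair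
  of principal directions. In particular the sum of the principal curvatures does not depend on the
  choice of these directions.
\<close>
lemma sum_principal_curvatures:
  assumes u: "u \<in> V" and \<kappa>: "principal_curvatures \<Psi> u \<kappa>\<^sub>1 \<kappa>\<^sub>2"
  shows "cross3 (\<partial> N v u) (\<partial> \<Psi> w u) + cross3 (\<partial> \<Psi> v u) (\<partial> N w u)
    = - (\<kappa>\<^sub>1 + \<kappa>\<^sub>2) *\<^sub>R cross3 (\<partial> \<Psi> v u) (\<partial> \<Psi> w u)"
proof -
  obtain p q where pq: "\<partial> \<Psi> p u \<noteq> \<partial> \<Psi> q u \<and> independent {\<partial> \<Psi> p u, \<partial> \<Psi> q u}"
    "- \<partial> N p u = \<kappa>\<^sub>1 *\<^sub>R \<partial> \<Psi> p u" "- \<partial> N q u = \<kappa>\<^sub>2 *\<^sub>R \<partial> \<Psi> q u"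
    using \<kappa> unfolding principal_curvatures_def tangent_plane_def
    by (auto simp: shape_operator_deriv[OF u])
  have indep: "cross3 (\<partial> \<Psi> p u) (\<partial> \<Psi> q u) \<noteq> 0"
    by (rule iffD1[OF independent_pair_iff_cross3 pq(1)])
  have p: "\<partial> N p u = - \<kappa>\<^sub>1 *\<^sub>R \<partial> \<Psi> p u" and q: "\<partial> N q u = - \<kappa>\<^sub>2 *\<^sub>R \<partial> \<Psi> q u"
    using arg_cong[OF pq(2), of uminus] arg_cong[OF pq(3), of uminus] by simp_all
  define d where "d v w = v $ 1 * w $ 2 - v $ 2 * w $ 1" for v w :: "real^2"
  define B where "B = cross3 (\<partial> N (axis 1 1) u) (\<partial> \<Psi> (axis 2 1) u)
    + cross3 (\<partial> \<Psi> (axis 1 1) u) (\<partial> N (axis 2 1) u)"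
  define n where "n = cross3 (\<partial> \<Psi> (axis 1 1) u) (\<partial> \<Psi> (axis 2 1) u)"
  have B: "cross3 (\<partial> N v u) (\<partial> \<Psi> w u) + cross3 (\<partial> \<Psi> v u) (\<partial> N w u) = d v w *\<^sub>R B"
    and n: "cross3 (\<partial> \<Psi> v u) (\<partial> \<Psi> w u) = d v w *\<^sub>R n" for v w
    unfolding B_def n_def d_def
    using cross3_linear_images[OF linear_deriv[OF u] linear_dN[OF u], of v w]
      cross3_linear_image[OF linear_deriv[OF u], of v w] by auto
  have "d p q *\<^sub>R B = d p q *\<^sub>R (- (\<kappa>\<^sub>1 + \<kappa>\<^sub>2) *\<^sub>R n)"
    unfolding B[symmetric] p q
    using n[of p q] by (simp add: cross3_bilinear algebra_simps)
  moreover have "d p q \<noteq> 0" using indep n[of p q] by auto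
  ultimately have "B = - (\<kappa>\<^sub>1 + \<kappa>\<^sub>2) *\<^sub>R n" by (simp only: scaleR_cancel_left) simp
  then show ?thesis unfolding B n by simp
qed

text \<open>
  In an orthonormal frame \<open>e\<close>, \<open>f\<close> of the tangent plane the shape operator is a symmetric matrix with
  diagonal entries \<open>r\<close>, \<open>t\<close> and off-diagonal entry \<open>s\<close>. If \<open>s \<noteq> 0\<close>, its eigenvalues \<open>ev 1\<close> and
  \<open>ev (-1)\<close> are distinct, with eigenvectors \<open>X 1\<close> and \<open>X (-1)\<close>.
\<close>
lemma principal_curvatures_exist:
  assumes u: "u \<in> V"
  shows "\<exists>\<kappa>\<^sub>1 \<kappa>\<^sub>2. principal_curvatures \<Psi> u \<kappa>\<^sub>1 \<kappa>\<^sub>2"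
proof -
  define a where "a = \<partial> \<Psi> (axis 1 1) u"
  define e where "e = a /\<^sub>R norm a"
  define f where "f = cross3 (N u) e"
  have "a \<noteq> 0" using normal_vec_nonzero[OF u] by (auto simp: normal_vec_def a_def)
  then have ee: "e \<bullet> e = 1" by (simp add: e_def dot_square_norm power2_eq_square)
  have eN: "e \<bullet> N u = 0" by (simp add: e_def a_def inner_deriv_N[OF u])
  have fN: "f \<bullet> N u = 0" and ef: "e \<bullet> f = 0" by (simp_all add: f_def dot_cross_self)
  have "f \<bullet> f = (N u \<bullet> N u) * (e \<bullet> e) - (e \<bullet> N u)\<^sup>2"
    using norm_cross_dot[of "N u" e] by (simp add: f_def dot_square_norm power_mult_distrib inner_commute)
  then have ff: "f \<bullet> f = 1" using ee eN inner_N_N[OF u] by simp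
  obtain p q where p: "e = \<partial> \<Psi> p u" and q: "f = \<partial> \<Psi> q u"
    using eN fN tangent_iff[OF u] by metis
  have cross: "cross3 e f \<noteq> 0"
    using norm_cross_dot[of e f] ee ff ef by (auto simp: norm_eq_1)
  have expand: "X = (X \<bullet> e) *\<^sub>R e + (X \<bullet> f) *\<^sub>R f" if X: "X \<bullet> N u = 0" for X
  proof -
    have n: "cross3 e f = N u"
      using ee eN unfolding f_def by (simp add: Lagrange)
    have "cross3 e f \<bullet> cross3 e f = 1" using inner_N_N[OF u] n by simp
    moreover have "cross3 X f \<bullet> cross3 e f = X \<bullet> e" "cross3 e X \<bullet> cross3 e f = X \<bullet> f"
      using ee ff ef by (simp_all add: dot_cross inner_commute)
    ultimately show ?thesis
      using cross3_frame_expand[of e f X] X n by simp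
  qed
  define r where "r = - \<partial> N p u \<bullet> e"
  define s where "s = - \<partial> N p u \<bullet> f"
  define t where "t = - \<partial> N q u \<bullet> f"
  have Se: "- \<partial> N p u = r *\<^sub>R e + s *\<^sub>R f"
    unfolding r_def s_def by (rule expand) (simp add: inner_dN_N[OF u])
  have s: "- \<partial> N q u \<bullet> e = s"
    using dN_symmetric[OF u, of q p] by (simp add: s_def p q)
  have Sf: "- \<partial> N q u = s *\<^sub>R e + t *\<^sub>R f"
    unfolding s[symmetric] t_def by (rule expand) (simp add: inner_dN_N[OF u])
  have S: "shape_operator \<Psi> u (x *\<^sub>R e + y *\<^sub>R f) = (x * r + y * s) *\<^sub>R e + (x * s + y * t) *\<^sub>R f"
    and tan: "x *\<^sub>R e + y *\<^sub>R f \<in> tangent_plane \<Psi> u" for x y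
  proof -
    have D: "x *\<^sub>R e + y *\<^sub>R f = \<partial> \<Psi> (x *\<^sub>R p + y *\<^sub>R q) u"
      unfolding p q using linear_deriv[OF u] by (simp add: linear_add linear_scale)
    then show "x *\<^sub>R e + y *\<^sub>R f \<in> tangent_plane \<Psi> u" by (auto simp: tangent_plane_def)
    have "shape_operator \<Psi> u (x *\<^sub>R e + y *\<^sub>R f) = - \<partial> N (x *\<^sub>R p + y *\<^sub>R q) u"
      unfolding D by (rule shape_operator_deriv[OF u])
    also have "\<dots> = x *\<^sub>R (- \<partial> N p u) + y *\<^sub>R (- \<partial> N q u)"
      using linear_dN[OF u] by (simp add: linear_add linear_scale)
    also have "\<dots> = (x * r + y * s) *\<^sub>R e + (x * s + y * t) *\<^sub>R f"
      unfolding Se Sf by (simp add: algebra_simps)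
    finally show "shape_operator \<Psi> u (x *\<^sub>R e + y *\<^sub>R f) = (x * r + y * s) *\<^sub>R e + (x * s + y * t) *\<^sub>R f" .
  qed
  show ?thesis
  proof (cases "s = 0")
    case True
    have "shape_operator \<Psi> u e = r *\<^sub>R e" "shape_operator \<Psi> u f = t *\<^sub>R f"
      "e \<in> tangent_plane \<Psi> u" "f \<in> tangent_plane \<Psi> u"
      using S[of 1 0] S[of 0 1] tan[of 1 0] tan[of 0 1] True by simp_all
    then show ?thesis
      unfolding principal_curvatures_def using cross independent_pair_iff_cross3[of e f] by blast
  next
    case False
    define w where "w = sqrt ((r - t)\<^sup>2 + 4 * s\<^sup>2)"
    have w: "w * w = (r - t)\<^sup>2 + 4 * s\<^sup>2" "w > 0"
      using False by (simp_all add: w_def add_nonneg_pos)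
    define ev where "ev \<sigma> = (r + t + \<sigma> * w) / 2" for \<sigma>
    define X where "X \<sigma> = s *\<^sub>R e + (ev \<sigma> - r) *\<^sub>R f" for \<sigma>
    have "shape_operator \<Psi> u (X \<sigma>) = ev \<sigma> *\<^sub>R X \<sigma>" if "\<sigma> * \<sigma> = 1" for \<sigma>
    proof -
      have "(\<sigma> * w) * (\<sigma> * w) = (r - t)\<^sup>2 + 4 * s\<^sup>2"
        using that w(1) by (simp add: mult_ac)
      then have eq: "s * s + (ev \<sigma> - r) * t = ev \<sigma> * (ev \<sigma> - r)"
        by (simp add: ev_def field_simps power2_eq_square)
      then show ?thesis unfolding X_def S eq by (simp add: algebra_simps)
    qed
    from this[of 1] this[of "-1"]
    have "shape_operator \<Psi> u (X 1) = ev 1 *\<^sub>R X 1" "shape_operator \<Psi> u (X (-1)) = ev (-1) *\<^sub>R X (-1)"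
      by simp_all
    moreover have "X \<sigma> \<in> tangent_plane \<Psi> u" for \<sigma> unfolding X_def by (rule tan)
    moreover have "cross3 (X 1) (X (-1)) = - (s * w) *\<^sub>R cross3 e f"
      unfolding X_def ev_def cross3_bilinear using cross_skew[of f e]
      by (simp add: algebra_simps add_divide_distrib diff_divide_distrib flip: scaleR_add_left)
    then have "cross3 (X 1) (X (-1)) \<noteq> 0" using cross False w by simp
    ultimately show ?thesis
      unfolding principal_curvatures_def using independent_pair_iff_cross3 by blast
  qed
qed

text \<open>
  The trace of the shape operator in terms of an arbitrary pair of tangent vectors, instead of a
  pair of principal directions.
\<close>
theorem mean_curvature_cross3:
  assumes u: "u \<in> V"
  shows "cross3 (\<partial> N v u) (\<partial> \<Psi> w u) + cross3 (\<partial> \<Psi> v u) (\<partial> N w u)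
    = - mean_curvature \<Psi> u *\<^sub>R cross3 (\<partial> \<Psi> v u) (\<partial> \<Psi> w u)"
proof -
  obtain \<kappa>\<^sub>1 \<kappa>\<^sub>2 where \<kappa>: "principal_curvatures \<Psi> u \<kappa>\<^sub>1 \<kappa>\<^sub>2"
    using principal_curvatures_exist[OF u] by blast
  have "mean_curvature \<Psi> u = \<kappa>\<^sub>1 + \<kappa>\<^sub>2"
    unfolding mean_curvature_def
  proof (rule the_equality)
    fix H assume "\<exists>l\<^sub>1 l\<^sub>2. principal_curvatures \<Psi> u l\<^sub>1 l\<^sub>2 \<and> H = l\<^sub>1 + l\<^sub>2"
    then obtain l\<^sub>1 l\<^sub>2 where l: "principal_curvatures \<Psi> u l\<^sub>1 l\<^sub>2" "H = l\<^sub>1 + l\<^sub>2" by blast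
    have "- (\<kappa>\<^sub>1 + \<kappa>\<^sub>2) *\<^sub>R normal_vec \<Psi> u = - (l\<^sub>1 + l\<^sub>2) *\<^sub>R normal_vec \<Psi> u"
      unfolding normal_vec_def
      by (metis sum_principal_curvatures[OF u \<kappa>] sum_principal_curvatures[OF u l(1)])
    then show "H = \<kappa>\<^sub>1 + \<kappa>\<^sub>2"
      using l(2) normal_vec_nonzero[OF u] by (simp only: scaleR_cancel_right) simp
  qed (use \<kappa> in blast)
  then show ?thesis using sum_principal_curvatures[OF u \<kappa>] by simp
qed

end

section \<open>Immersed surfaces and their energy in a chart\<close>

locale immersed_surface =
  fixes \<A> :: "'a::{t2_space, second_countable_topology} atlas" and \<Phi> :: "'a \<Rightarrow> real^3"
  assumes atlas: "oriented_atlas \<A>" and immersion: "smooth_immersion \<A> \<Phi>"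
begin

lemma
  assumes "(V, x) \<in> \<A>"
  shows open_chart_domain: "open V" and open_chart_image: "open (x ` V)"
    and chart_homeomorphism: "homeomorphism V (x ` V) x (inv_into V x)"
  using atlas assms unfolding oriented_atlas_def by blast+

lemma chart_continuous: "(V, x) \<in> \<A> \<Longrightarrow> continuous_on V x"
  using chart_homeomorphism by (auto simp: homeomorphism_def)

lemma chart_inverse_continuous: "(V, x) \<in> \<A> \<Longrightarrow> continuous_on (x ` V) (inv_into V x)"
  using chart_homeomorphism unfolding homeomorphism_def by blast

lemma chart_inverse: "(V, x) \<in> \<A> \<Longrightarrow> u \<in> V \<Longrightarrow> inv_into V x (x u) = u"
  using chart_homeomorphism unfolding homeomorphism_def by blast

lemma chart_cover: obtains V x u where "(V, x) \<in> \<A>" "u \<in> V" "p = x u"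
proof -
  have "p \<in> (\<Union>(V, x)\<in>\<A>. x ` V)"
    using atlas by (simp add: oriented_atlas_def)
  then show thesis using that by auto
qed

lemma transition_domain_open:
  assumes "(V, x) \<in> \<A>" "(W, y) \<in> \<A>"
  shows "open (W \<inter> y -` (x ` V))"
  using continuous_on_open_vimage[OF open_chart_domain[OF assms(2)]] chart_continuous[OF assms(2)]
    open_chart_image[OF assms(1)] by (metis Int_commute)

lemma transition_smooth:
  assumes "(V, x) \<in> \<A>" "(W, y) \<in> \<A>"
  shows "smooth_on (W \<inter> y -` (x ` V)) (inv_into V x \<circ> y)"
  using atlas assms unfolding oriented_atlas_def by blast

lemma transition_det:
  assumes "(V, x) \<in> \<A>" "(W, y) \<in> \<A>" "w \<in> W \<inter> y -` (x ` V)"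
  shows "0 < det (matrix (frechet_derivative (inv_into V x \<circ> y) (at w)))"
  using atlas assms unfolding oriented_atlas_def by blast

lemma immersed_patch: "(V, x) \<in> \<A> \<Longrightarrow> immersed_patch V (\<Phi> \<circ> x)"
  using immersion open_chart_domain unfolding smooth_immersion_def by unfold_locales blast+

lemma immersion_continuous: "continuous_on UNIV \<Phi>"
  unfolding continuous_on_eq_continuous_at[OF open_UNIV]
proof
  fix p
  obtain V x u where x: "(V, x) \<in> \<A>" "u \<in> V" "p = x u" by (rule chart_cover)
  interpret immersed_patch V "\<Phi> \<circ> x" by (rule immersed_patch[OF x(1)])
  have "continuous_on (x ` V) (\<lambda>q. (\<Phi> \<circ> x) (inv_into V x q))"
    using chart_inverse[OF x(1)]
    by (intro continuous_on_compose2[OF smooth_on_imp_continuous_on[OF smooth]]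
        chart_inverse_continuous[OF x(1)]) auto
  then have "continuous_on (x ` V) \<Phi>"
    by (rule continuous_on_eq) (auto simp: chart_inverse[OF x(1)])
  then show "isCont \<Phi> p"
    using open_chart_image[OF x(1)] x continuous_on_eq_continuous_at by blast
qed

text \<open>
  The area measure is prescribed on the images of Borel sets of parameters, so restricted to a
  compact piece \<open>x ` C\<close> of a chart it is the image under \<open>x\<close> of a measure with density.
\<close>
lemma area_measure_integral:
  fixes f :: "'a \<Rightarrow> real"
  assumes x: "(V, x) \<in> \<A>" and \<mu>: "is_area_measure \<A> \<Phi> \<mu>" and C: "compact C" "C \<subseteq> V"
    and f: "f \<in> borel_measurable borel" and fx: "continuous_on C (\<lambda>u. f (x u))"
  shows "(LINT p:x ` C|\<mu>. f p) = integral C (\<lambda>u. norm (normal_vec (\<Phi> \<circ> x) u) * f (x u))"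
proof -
  interpret immersed_patch V "\<Phi> \<circ> x" by (rule immersed_patch[OF x])
  \<comment> \<open>\<open>x'\<close> extends \<open>x\<close> by an arbitrary constant to a Borel map on the whole plane.\<close>
  define p\<^sub>0 :: 'a where "p\<^sub>0 = undefined"
  define x' where "x' u = (if u \<in> V then x u else p\<^sub>0)" for u
  define w where "w u = indicator C u * norm (normal_vec (\<Phi> \<circ> x) u)" for u
  have sets_\<mu>: "sets \<mu> = sets borel" using \<mu> by (simp add: is_area_measure_def)
  have x'_meas: "x' \<in> borel_measurable borel"
    unfolding x'_def
    by (intro borel_measurable_continuous_on_if chart_continuous[OF x] continuous_on_const
        borel_open open_V)
  have cont_n: "continuous_on C (\<lambda>u. norm (normal_vec (\<Phi> \<circ> x) u))"
    by (intro continuous_on_norm continuous_on_subset[OF smooth_on_imp_continuous_on[OF smooth_normal_vec] C(2)])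
  have C_sets: "C \<in> sets borel" using C by (simp add: borel_compact)
  have w_meas: "w \<in> borel_measurable borel"
    unfolding w_def
    using borel_measurable_continuous_on_indicator[OF C_sets cont_n] by simp
  have K: "x ` C \<in> sets borel"
    by (intro borel_compact compact_continuous_image continuous_on_subset[OF chart_continuous[OF x]] C)
  have measures: "distr (density lborel w) borel x' = density \<mu> (indicator (x ` C))"
  proof (rule measure_eqI)
    fix A assume "A \<in> sets (distr (density lborel w) borel x')"
    then have A: "A \<in> sets borel" by simp
    define B where "B = C \<inter> x' -` A"
    have B: "B \<in> sets borel" "B \<subseteq> V" "x ` B = x ` C \<inter> A"
      using measurable_sets[OF x'_meas A] C_sets C(2) by (auto simp: B_def x'_def)
    have "emeasure (distr (density lborel w) borel x') A = (\<integral>\<^sup>+u. ennreal (w u) * indicator (x' -` A) u \<partial>lborel)"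
      using A x'_meas w_meas measurable_sets[OF x'_meas A]
      by (simp add: emeasure_distr emeasure_density)
    also have "\<dots> = (\<integral>\<^sup>+u\<in>B. ennreal (norm (normal_vec (\<Phi> \<circ> x) u)) \<partial>lborel)"
      by (intro nn_integral_cong) (auto simp: w_def B_def indicator_def)
    also have "\<dots> = emeasure \<mu> (x ` B)"
      using \<mu> x B unfolding is_area_measure_def by fastforce
    also have "\<dots> = (\<integral>\<^sup>+p. indicator (x ` C \<inter> A) p \<partial>\<mu>)"
      unfolding B(3) using K A sets_\<mu> by (intro nn_integral_indicator[symmetric]) auto
    also have "\<dots> = (\<integral>\<^sup>+p. indicator (x ` C) p * indicator A p \<partial>\<mu>)"
      by (intro nn_integral_cong) (auto simp: indicator_def)
    also have "\<dots> = emeasure (density \<mu> (indicator (x ` C))) A"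
      using K A sets_\<mu> by (intro emeasure_density[symmetric]) auto
    finally show "emeasure (distr (density lborel w) borel x') A
      = emeasure (density \<mu> (indicator (x ` C))) A" .
  qed (simp add: sets_\<mu>)
  have f_\<mu>: "f \<in> borel_measurable \<mu>"
    using f sets_\<mu> by (simp cong: measurable_cong_sets)
  have "(LINT p:x ` C|\<mu>. f p) = integral\<^sup>L (density \<mu> (\<lambda>p. ennreal (indicator (x ` C) p))) f"
    unfolding set_lebesgue_integral_def
    using K sets_\<mu> by (intro integral_density[symmetric] f_\<mu>) auto
  also have "\<dots> = integral\<^sup>L (distr (density lborel w) borel x') f"
    unfolding measures by (simp add: ennreal_indicator)
  also have "\<dots> = integral\<^sup>L (density lborel w) (\<lambda>u. f (x' u))"
    using x'_meas f by (intro integral_distr) auto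
  also have "\<dots> = (\<integral>u. w u *\<^sub>R f (x' u) \<partial>lborel)"
  proof (rule integral_density)
    show "(\<lambda>u. f (x' u)) \<in> borel_measurable lborel"
      using measurable_compose[OF x'_meas f] by simp
    show "w \<in> borel_measurable lborel" using w_meas by simp
    show "AE u in lborel. 0 \<le> w u" by (simp add: w_def)
  qed
  also have "\<dots> = (LINT u:C|lborel. norm (normal_vec (\<Phi> \<circ> x) u) * f (x u))"
    unfolding set_lebesgue_integral_def
    using C(2) by (intro Bochner_Integration.integral_cong) (auto simp: w_def x'_def indicator_def)
  also have "\<dots> = integral C (\<lambda>u. norm (normal_vec (\<Phi> \<circ> x) u) * f (x u))"
    by (rule set_borel_integral_eq_integral)
       (unfold set_integrable_def, intro borel_integrable_compact C(1) continuous_on_mult cont_n fx)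
  finally show ?thesis .
qed

lemma energy_in_chart:
  assumes x: "(V, x) \<in> \<A>" and C: "compact C" "C \<subseteq> V" and ne: "\<And>u. u \<in> C \<Longrightarrow> \<Phi> (x u) \<noteq> 0"
    and E: "has_energy \<A> \<alpha> (x ` C) \<Phi> E"
  shows "E = integral C (\<lambda>u. norm (normal_vec (\<Phi> \<circ> x) u) * norm (\<Phi> (x u)) powr \<alpha>)"
proof -
  obtain \<mu> where \<mu>: "is_area_measure \<A> \<Phi> \<mu>" and E: "E = (LINT p:x ` C|\<mu>. norm (\<Phi> p) powr \<alpha>)"
    using E by (auto simp: has_energy_def)
  have "\<Phi> \<in> borel_measurable borel"
    using immersion_continuous by (rule borel_measurable_continuous_onI)
  then have "(\<lambda>p. norm (\<Phi> p) powr \<alpha>) \<in> borel_measurable borel"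
    by measurable
  moreover have "continuous_on C (\<lambda>u. norm (\<Phi> (x u)) powr \<alpha>)"
    using ne
    by (intro continuous_on_powr continuous_on_norm continuous_on_const
        continuous_on_compose2[OF immersion_continuous]
        continuous_on_subset[OF chart_continuous[OF x] C(2)]) auto
  ultimately show ?thesis
    unfolding E by (rule area_measure_integral[OF x \<mu> C])
qed

end

section \<open>Variations supported in a chart\<close>

text \<open>
  Compactness makes the bound on \<open>t\<close> uniform in \<open>u\<close>. The lemma keeps the varied surface immersed and
  away from the origin.
\<close>
lemma affine_nonvanishing:
  fixes a b :: "'c::topological_space \<Rightarrow> 'b::real_normed_vector"
  assumes C: "compact C" and a: "continuous_on C a" and b: "continuous_on C b"
    and ne: "\<And>u. u \<in> C \<Longrightarrow> a u \<noteq> 0"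
  obtains e where "e > 0" "\<And>t u. \<bar>t\<bar> < e \<Longrightarrow> u \<in> C \<Longrightarrow> a u + t *\<^sub>R b u \<noteq> 0"
proof (cases "C = {}")
  case True
  then show thesis using that[of 1] by auto
next
  case False
  obtain u\<^sub>0 where u\<^sub>0: "u\<^sub>0 \<in> C" "\<And>u. u \<in> C \<Longrightarrow> norm (a u\<^sub>0) \<le> norm (a u)"
    using continuous_attains_inf[OF C False continuous_on_norm[OF a]] by blast
  obtain u\<^sub>1 where u\<^sub>1: "u\<^sub>1 \<in> C" "\<And>u. u \<in> C \<Longrightarrow> norm (b u) \<le> norm (b u\<^sub>1)"
    using continuous_attains_sup[OF C False continuous_on_norm[OF b]] by blast
  have pos: "1 + norm (b u\<^sub>1) > 0" by (simp add: add_pos_nonneg)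
  show thesis
  proof (rule that[of "norm (a u\<^sub>0) / (1 + norm (b u\<^sub>1))"])
    show "norm (a u\<^sub>0) / (1 + norm (b u\<^sub>1)) > 0" using ne[OF u\<^sub>0(1)] pos by simp
    fix t u assume t: "\<bar>t\<bar> < norm (a u\<^sub>0) / (1 + norm (b u\<^sub>1))" and u: "u \<in> C"
    have "norm (t *\<^sub>R b u) \<le> \<bar>t\<bar> * (1 + norm (b u\<^sub>1))"
      using u\<^sub>1(2)[OF u] by (simp add: mult_left_mono)
    also have "\<dots> < norm (a u\<^sub>0)" using t pos by (simp add: field_simps)
    also have "\<dots> \<le> norm (a u)" by (rule u\<^sub>0(2)[OF u])
    finally show "a u + t *\<^sub>R b u \<noteq> 0"
      by (metis add_eq_0_iff norm_minus_cancel order_less_irrefl)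
  qed
qed

lemma has_real_derivative_norm_powr_affine:
  fixes a b :: "'b::real_inner"
  assumes "a + t *\<^sub>R b \<noteq> 0"
  shows "((\<lambda>t. norm (a + t *\<^sub>R b) powr \<beta>) has_real_derivative
    \<beta> * norm (a + t *\<^sub>R b) powr (\<beta> - 2) * ((a + t *\<^sub>R b) \<bullet> b)) (at t)"
proof -
  have norm_powr: "norm y powr \<gamma> = (y \<bullet> y) powr (\<gamma> / 2)" for y :: 'b and \<gamma>
    by (simp add: norm_eq_sqrt_inner powr_half_sqrt[symmetric] powr_powr)
  have "((\<lambda>t. (a + t *\<^sub>R b) \<bullet> (a + t *\<^sub>R b)) has_real_derivative 2 * ((a + t *\<^sub>R b) \<bullet> b)) (at t)"
  proof -
    have eq: "(\<lambda>t. (a + t *\<^sub>R b) \<bullet> (a + t *\<^sub>R b)) = (\<lambda>t. a \<bullet> a + 2 * t * (a \<bullet> b) + t * t * (b \<bullet> b))"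
      by (auto simp: inner_add_left inner_add_right inner_commute algebra_simps)
    show ?thesis unfolding eq
      by (auto intro!: derivative_eq_intros simp: inner_add_left algebra_simps)
  qed
  from DERIV_chain2[OF has_real_derivative_powr[of "(a + t *\<^sub>R b) \<bullet> (a + t *\<^sub>R b)" "\<beta> / 2"] this]
  have "((\<lambda>t. ((a + t *\<^sub>R b) \<bullet> (a + t *\<^sub>R b)) powr (\<beta> / 2)) has_real_derivative
      \<beta> / 2 * ((a + t *\<^sub>R b) \<bullet> (a + t *\<^sub>R b)) powr (\<beta> / 2 - 1) * (2 * ((a + t *\<^sub>R b) \<bullet> b))) (at t)"
    using assms by simp
  moreover have "\<beta> / 2 - 1 = (\<beta> - 2) / 2" by simp
  ultimately show ?thesis unfolding norm_powr by (simp add: mult_ac)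
qed

locale chart_variation = immersed_surface \<A> \<Phi>
  for \<A> :: "'a::{t2_space, second_countable_topology} atlas" and \<Phi> :: "'a \<Rightarrow> real^3" +
  fixes V :: "(real^2) set" and x :: "real^2 \<Rightarrow> 'a"
    and C :: "(real^2) set" and \<phi> :: "real^2 \<Rightarrow> real" and Z :: "real^3"
  assumes x: "(V, x) \<in> \<A>"
    and C: "compact C" "C \<subseteq> V"
    and \<phi>: "smooth_on UNIV \<phi>" "u \<notin> C \<Longrightarrow> \<phi> u = 0"
begin

sublocale immersed_patch V "\<Phi> \<circ> x"
  by (rule immersed_patch[OF x])

text \<open>
  The coefficient \<open>\<phi>\<close> transported to the surface.
\<close>
definition \<psi> :: "'a \<Rightarrow> real" where
  "\<psi> p = (if p \<in> x ` V then \<phi> (inv_into V x p) else 0)"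

definition F :: "real \<Rightarrow> 'a \<Rightarrow> real^3" where
  "F t p = \<Phi> p + (t * \<psi> p) *\<^sub>R Z"

text \<open>
  The derivative with respect to \<open>t\<close> of the normal vector of the varied surface.
\<close>
definition m :: "real^2 \<Rightarrow> real^3" where
  "m u = \<partial> \<phi> (axis 1 1) u *\<^sub>R cross3 Z (\<partial> (\<Phi> \<circ> x) (axis 2 1) u)
    + \<partial> \<phi> (axis 2 1) u *\<^sub>R cross3 (\<partial> (\<Phi> \<circ> x) (axis 1 1) u) Z"

lemma \<psi>_chart: "u \<in> V \<Longrightarrow> \<psi> (x u) = \<phi> u"
  by (simp add: \<psi>_def chart_inverse[OF x])

lemma \<psi>_outside: "p \<notin> x ` C \<Longrightarrow> \<psi> p = 0"
  using \<phi>(2) chart_inverse[OF x] by (fastforce simp: \<psi>_def)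

lemma closed_support: "closed (x ` C)"
  by (intro compact_imp_closed compact_continuous_image continuous_on_subset[OF chart_continuous[OF x]] C)

lemma open_off_support:
  assumes y: "(W, y) \<in> \<A>"
  shows "open (W \<inter> y -` (- (x ` C)))"
  using continuous_on_open_vimage[OF open_chart_domain[OF y]] chart_continuous[OF y]
    closed_support by (metis Int_commute open_Compl)

text \<open>
  The domain of the other chart is covered by two open sets: on one of them \<open>\<psi>\<close> is \<open>\<phi>\<close> composed with
  a transition map, on the other it vanishes. The latter is open because the compact support is
  closed in the Hausdorff space \<open>'a\<close>.
\<close>
lemma smooth_\<psi>:
  assumes y: "(W, y) \<in> \<A>"
  shows "smooth_on W (\<lambda>w. \<psi> (y w))"
proof -
  let ?T = "W \<inter> y -` (x ` V)" and ?O = "W \<inter> y -` (- (x ` C))"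
  have "smooth_on ?T (\<lambda>w. \<phi> ((inv_into V x \<circ> y) w))"
    by (rule smooth_on_compose[OF transition_domain_open[OF x y] open_UNIV subset_UNIV
          transition_smooth[OF x y] \<phi>(1)])
  then have "smooth_on ?T (\<lambda>w. \<psi> (y w))"
    by (rule smooth_on_cong[OF transition_domain_open[OF x y], rotated]) (auto simp: \<psi>_def)
  then have "smooth_on (?T \<union> ?O) (\<lambda>w. \<psi> (y w))"
    by (rule smooth_on_Un_zero[OF transition_domain_open[OF x y] open_off_support[OF y]])
       (simp add: \<psi>_outside)
  moreover have "?T \<union> ?O = W" using C(2) by blast
  ultimately show ?thesis by simp
qed

lemma smooth_F:
  assumes y: "(W, y) \<in> \<A>"
  shows "smooth_on W (F t \<circ> y)"
    and "smooth_on ({-e<..<e} \<times> W) (\<lambda>(t, u). F t (y u))"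
proof -
  interpret Y: immersed_patch W "\<Phi> \<circ> y" by (rule immersed_patch[OF y])
  show "smooth_on W (F t \<circ> y)"
    using smooth_on_add[OF Y.open_V Y.smooth smooth_on_scaleR[OF Y.open_V
          smooth_on_mult[OF Y.open_V smooth_on_const smooth_\<psi>[OF y]] smooth_on_const], of t Z]
    by (simp add: F_def comp_def)
  let ?S = "{-e<..<e} \<times> W"
  have S: "open ?S" by (intro open_Times Y.open_V) auto
  have fst: "smooth_on ?S fst" and snd: "smooth_on ?S snd"
    by (intro smooth_on_linear bounded_linear_fst bounded_linear_snd)+
  have sub: "snd ` ?S \<subseteq> W" by auto
  note comp = smooth_on_compose[OF S Y.open_V sub snd]
  show "smooth_on ?S (\<lambda>(t, u). F t (y u))"
    using smooth_on_add[OF S comp[OF Y.smooth] smooth_on_scaleR[OF S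
          smooth_on_mult[OF S fst comp[OF smooth_\<psi>[OF y]]] smooth_on_const], of Z]
    by (simp add: F_def comp_def case_prod_unfold)
qed

lemma has_derivative_F:
  assumes u: "u \<in> V"
  shows "((F t \<circ> x) has_derivative (\<lambda>v. \<partial> (\<Phi> \<circ> x) v u + (t * \<partial> \<phi> v u) *\<^sub>R Z)) (at u)"
proof (rule has_derivative_transform_within_open[OF _ open_V u])
  have \<phi>': "(\<phi> has_derivative (\<lambda>v. \<partial> \<phi> v u)) (at u)"
    by (rule smooth_on_has_derivative[OF \<phi>(1)]) simp
  show "((\<lambda>u. (\<Phi> \<circ> x) u + (t * \<phi> u) *\<^sub>R Z) has_derivative
      (\<lambda>v. \<partial> (\<Phi> \<circ> x) v u + (t * \<partial> \<phi> v u) *\<^sub>R Z)) (at u)"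
    by (intro has_derivative_add smooth_on_has_derivative[OF smooth u] has_derivative_scaleR_left
        has_derivative_mult_right \<phi>')
qed (simp add: F_def \<psi>_chart)

text \<open>
  The variation vector field has the fixed direction \<open>Z\<close>, so the term quadratic in \<open>t\<close> contains
  \<open>cross3 Z Z\<close> and vanishes.
\<close>
lemma normal_vec_F:
  assumes u: "u \<in> V"
  shows "normal_vec (F t \<circ> x) u = normal_vec (\<Phi> \<circ> x) u + t *\<^sub>R m u"
  unfolding normal_vec_def m_def dir_deriv_eqI[OF has_derivative_F[OF u]]
  by (simp add: cross3_bilinear algebra_simps)

lemma m_outside:
  assumes "u \<notin> C"
  shows "m u = 0"
proof -
  have "\<partial> \<phi> v u = 0" for v
    by (rule dir_deriv_locally_const[of "- C" _ _ 0])
       (use assms C(1) \<phi>(2) in \<open>auto intro: compact_imp_closed\<close>)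
  then show ?thesis by (simp add: m_def)
qed

lemma continuous_m: "continuous_on V m"
  unfolding m_def
  by (intro continuous_on_add continuous_on_scaleR continuous_on_cross continuous_on_const
      smooth_on_imp_continuous_on[OF smooth_on_dir_deriv[OF smooth]]
      smooth_on_imp_continuous_on[OF smooth_on_subset[OF smooth_on_dir_deriv[OF \<phi>(1)] subset_UNIV]])

text \<open>
  Immersivity in the chart \<open>x\<close> amounts to a nonvanishing normal vector, which is a compactness
  argument on \<open>C\<close> and trivial outside. In every other chart \<open>F t\<close> either differs from this by a
  transition map, whose derivative is invertible, or coincides locally with \<open>\<Phi>\<close>.
\<close>
lemma eventually_immersion:
  obtains e where "e > 0" "\<And>t. \<bar>t\<bar> < e \<Longrightarrow> smooth_immersion \<A> (F t)"
proof -
  obtain e where e: "e > 0"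
    and C_ne: "\<And>t u. \<bar>t\<bar> < e \<Longrightarrow> u \<in> C \<Longrightarrow> normal_vec (\<Phi> \<circ> x) u + t *\<^sub>R m u \<noteq> 0"
    using affine_nonvanishing[OF C(1)
        continuous_on_subset[OF smooth_on_imp_continuous_on[OF smooth_normal_vec] C(2)]
        continuous_on_subset[OF continuous_m C(2)]] normal_vec_nonzero C(2) by blast
  have inj_x: "inj (frechet_derivative (F t \<circ> x) (at u))" if t: "\<bar>t\<bar> < e" and u: "u \<in> V" for t u
  proof -
    have "normal_vec (F t \<circ> x) u \<noteq> 0"
      unfolding normal_vec_F[OF u]
      using C_ne[OF t] normal_vec_nonzero[OF u] m_outside[of u] by (cases "u \<in> C") auto
    moreover have "linear (frechet_derivative (F t \<circ> x) (at u))"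
      using has_derivative_F[OF u] by (intro linear_frechet_derivative) (auto simp: differentiable_def)
    ultimately show ?thesis by (simp add: inj_linear_real2_iff normal_vec_def)
  qed
  have "smooth_immersion \<A> (F t)" if t: "\<bar>t\<bar> < e" for t
    unfolding smooth_immersion_def
  proof clarify
    fix W y assume y: "(W, y) \<in> \<A>"
    interpret Y: immersed_patch W "\<Phi> \<circ> y" by (rule immersed_patch[OF y])
    have "inj (frechet_derivative (F t \<circ> y) (at w))" if w: "w \<in> W" for w
    proof (cases "y w \<in> x ` V")
      case True
      let ?T = "W \<inter> y -` (x ` V)" and ?\<tau> = "inv_into V x \<circ> y"
      have w: "w \<in> ?T" using True w by simp
      then have \<tau>w: "?\<tau> w \<in> V" by (auto intro: inv_into_into)
      have "((\<lambda>w. (F t \<circ> x) (?\<tau> w)) has_derivative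
          (\<lambda>v. \<partial> (F t \<circ> x) (\<partial> ?\<tau> v w) (?\<tau> w))) (at w)"
        using smooth_on_has_derivative[OF transition_smooth[OF x y] w]
          smooth_on_has_derivative[OF smooth_F(1)[OF x] \<tau>w] by (rule has_derivative_compose)
      then have "((F t \<circ> y) has_derivative (\<lambda>v. \<partial> (F t \<circ> x) (\<partial> ?\<tau> v w) (?\<tau> w))) (at w)"
        by (rule has_derivative_transform_within_open[OF _ transition_domain_open[OF x y] w])
           (auto simp: f_inv_into_f)
      then have D: "frechet_derivative (F t \<circ> y) (at w)
          = (\<lambda>v. \<partial> (F t \<circ> x) (\<partial> ?\<tau> v w) (?\<tau> w))"
        by (rule frechet_derivative_at[symmetric])
      have lin: "linear (frechet_derivative ?\<tau> (at w))"
        by (intro linear_frechet_derivative smooth_on_differentiable[OF transition_smooth[OF x y] w])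
      have "inj ((*v) (matrix (frechet_derivative ?\<tau> (at w))))"
        using transition_det[OF x y w] by (intro inj_matrix_vector_mult) (simp add: invertible_det_nz)
      moreover have "(*v) (matrix (frechet_derivative ?\<tau> (at w))) = frechet_derivative ?\<tau> (at w)"
        using matrix_works[OF lin[unfolded linear_matrix_vector_mul_eq[symmetric]]] by (rule ext)
      ultimately have "inj (frechet_derivative ?\<tau> (at w))" by simp
      from inj_compose[OF inj_x[OF t \<tau>w] this] show ?thesis unfolding D by (simp add: comp_def)
    next
      case False
      then have w: "w \<in> W \<inter> y -` (- (x ` C))" using w C(2) by auto
      have "((F t \<circ> y) has_derivative (\<lambda>v. \<partial> (\<Phi> \<circ> y) v w)) (at w)"
        by (rule has_derivative_transform_within_open[OF
              smooth_on_has_derivative[OF Y.smooth IntD1[OF w]] open_off_support[OF y] w])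
           (simp add: F_def \<psi>_outside)
      then have "frechet_derivative (F t \<circ> y) (at w) = frechet_derivative (\<Phi> \<circ> y) (at w)"
        by (simp add: frechet_derivative_at[symmetric])
      then show ?thesis using Y.inj_deriv w by simp
    qed
    then show "smooth_on W (F t \<circ> y) \<and> (\<forall>u\<in>W. inj (frechet_derivative (F t \<circ> y) (at u)))"
      using smooth_F(1)[OF y] by blast
  qed
  then show thesis using that e by blast
qed

lemma compact_variation_F:
  assumes "e > 0" "\<And>t. \<bar>t\<bar> < e \<Longrightarrow> smooth_immersion \<A> (F t)"
  shows "compact_variation \<A> \<Phi> (x ` C) e F"
  unfolding compact_variation_def
proof (intro conjI)
  show "compact (x ` C)"
    by (intro compact_continuous_image continuous_on_subset[OF chart_continuous[OF x]] C)
  show "F 0 = \<Phi>" by (auto simp: F_def)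
  show "\<forall>(W, y)\<in>\<A>. smooth_on ({-e<..<e} \<times> W) (\<lambda>(t, u). F t (y u))"
    using smooth_F(2) by blast
  show "\<forall>t\<in>{-e<..<e}. smooth_immersion \<A> (F t) \<and> (\<forall>p. p \<notin> x ` C \<longrightarrow> F t p = \<Phi> p)"
    using assms(2) \<psi>_outside by (auto simp: F_def)
qed (fact assms(1))

text \<open>Differentiation of the energy under the integral sign.\<close>
theorem first_variation:
  assumes "stationary \<A> \<alpha> \<Phi>" "0 \<notin> range \<Phi>" and box: "C = cbox p q"
  shows "integral C (\<lambda>u. (N u \<bullet> m u) * norm (\<Phi> (x u)) powr \<alpha>
    + norm (normal_vec (\<Phi> \<circ> x) u) * (\<alpha> * norm (\<Phi> (x u)) powr (\<alpha> - 2) * (\<Phi> (x u) \<bullet> (\<phi> u *\<^sub>R Z)))) = 0"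
proof -
  let ?n = "normal_vec (\<Phi> \<circ> x)" and ?\<Psi> = "\<lambda>u. \<Phi> (x u)"
  obtain e\<^sub>1 where e\<^sub>1: "e\<^sub>1 > 0" "\<And>t. \<bar>t\<bar> < e\<^sub>1 \<Longrightarrow> smooth_immersion \<A> (F t)"
    using eventually_immersion by blast
  have cont: "continuous_on C ?\<Psi>" "continuous_on C ?n" "continuous_on C m"
    "continuous_on C (\<lambda>u. \<phi> u *\<^sub>R Z)"
    using smooth_on_imp_continuous_on[OF smooth] smooth_on_imp_continuous_on[OF smooth_normal_vec]
      continuous_m smooth_on_imp_continuous_on[OF \<phi>(1)] C(2)
    by (auto intro!: continuous_intros intro: continuous_on_subset simp: comp_def)
  obtain e\<^sub>2 where e\<^sub>2: "e\<^sub>2 > 0" "\<And>t u. \<bar>t\<bar> < e\<^sub>2 \<Longrightarrow> u \<in> C \<Longrightarrow> ?\<Psi> u + t *\<^sub>R (\<phi> u *\<^sub>R Z) \<noteq> 0"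
    using affine_nonvanishing[OF C(1) cont(1,4)] assms(2) by (metis rangeI)
  obtain e\<^sub>3 where e\<^sub>3: "e\<^sub>3 > 0" "\<And>t u. \<bar>t\<bar> < e\<^sub>3 \<Longrightarrow> u \<in> C \<Longrightarrow> ?n u + t *\<^sub>R m u \<noteq> 0"
    using affine_nonvanishing[OF C(1) cont(2,3)] normal_vec_nonzero C(2) by (metis subsetD)
  define e where "e = min e\<^sub>1 (min e\<^sub>2 e\<^sub>3)"
  have e: "e > 0" using e\<^sub>1 e\<^sub>2 e\<^sub>3 by (simp add: e_def)
  have "compact_variation \<A> \<Phi> (x ` C) e F"
    using e e\<^sub>1 by (intro compact_variation_F) (auto simp: e_def)
  then obtain E where E: "\<And>t. t \<in> {-e<..<e} \<Longrightarrow> has_energy \<A> \<alpha> (x ` C) (F t) (E t)"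
    and E': "(E has_real_derivative 0) (at 0)"
    using assms(1) unfolding stationary_def by blast
  \<comment> \<open>The exponent 1 lets one differentiation rule serve for both factors.\<close>
  define L where "L t u = norm (?n u + t *\<^sub>R m u) powr 1 * norm (?\<Psi> u + t *\<^sub>R (\<phi> u *\<^sub>R Z)) powr \<alpha>" for t u
  define L' where "L' t u =
      1 * norm (?n u + t *\<^sub>R m u) powr (1 - 2) * ((?n u + t *\<^sub>R m u) \<bullet> m u) *
        norm (?\<Psi> u + t *\<^sub>R (\<phi> u *\<^sub>R Z)) powr \<alpha>
    + \<alpha> * norm (?\<Psi> u + t *\<^sub>R (\<phi> u *\<^sub>R Z)) powr (\<alpha> - 2) * ((?\<Psi> u + t *\<^sub>R (\<phi> u *\<^sub>R Z)) \<bullet> (\<phi> u *\<^sub>R Z)) *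
        norm (?n u + t *\<^sub>R m u) powr 1" for t u
  have ne: "?\<Psi> u + t *\<^sub>R (\<phi> u *\<^sub>R Z) \<noteq> 0" "?n u + t *\<^sub>R m u \<noteq> 0" if "t \<in> {-e<..<e}" "u \<in> C" for t u
  proof -
    have "\<bar>t\<bar> < e\<^sub>2" "\<bar>t\<bar> < e\<^sub>3" using that(1) by (auto simp: e_def)
    then show "?\<Psi> u + t *\<^sub>R (\<phi> u *\<^sub>R Z) \<noteq> 0" "?n u + t *\<^sub>R m u \<noteq> 0"
      using e\<^sub>2(2)[OF _ that(2)] e\<^sub>3(2)[OF _ that(2)] by blast+
  qed
  have EL: "E t = integral C (L t)" if t: "t \<in> {-e<..<e}" for t
  proof -
    have "\<bar>t\<bar> < e\<^sub>1" using t by (auto simp: e_def)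
    then interpret Ft: immersed_surface \<A> "F t"
      using atlas e\<^sub>1(2) by unfold_locales
    have F: "F t (x u) = ?\<Psi> u + t *\<^sub>R (\<phi> u *\<^sub>R Z)" if "u \<in> C" for u
      using that C(2) by (auto simp: F_def \<psi>_chart)
    have "E t = integral C (\<lambda>u. norm (normal_vec (F t \<circ> x) u) * norm (F t (x u)) powr \<alpha>)"
      by (rule Ft.energy_in_chart[OF x C _ E[OF t]]) (use ne[OF t] in \<open>simp add: F\<close>)
    also have "\<dots> = integral C (L t)"
      using C(2) by (intro integral_cong) (auto simp: F L_def normal_vec_F powr_one)
    finally show ?thesis .
  qed
  have "((\<lambda>t. integral (cbox p q) (L t)) has_real_derivative integral (cbox p q) (L' 0))
      (at 0 within {-e<..<e})"
  proof (rule leibniz_rule_field_derivative)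
    fix t u assume tu: "t \<in> {-e<..<e}" "u \<in> cbox p q"
    then have "u \<in> C" by (simp add: box)
    note ne = ne[OF tu(1) this]
    show "((\<lambda>t. L t u) has_real_derivative L' t u) (at t within {-e<..<e})"
      unfolding L_def L'_def
      by (rule DERIV_subset[OF DERIV_mult'[OF has_real_derivative_norm_powr_affine[OF ne(2), of 1]
              has_real_derivative_norm_powr_affine[OF ne(1), of \<alpha>], THEN DERIV_cong] subset_UNIV])
         (simp add: add.commute mult.commute)
  next
    fix t assume "t \<in> {-e<..<e}"
    then show "L t integrable_on cbox p q"
      unfolding L_def box[symmetric] using ne
      by (intro integrable_continuous[of p q, folded box] continuous_on_mult continuous_on_powr
          continuous_on_norm continuous_on_add continuous_on_scaleR[OF continuous_on_const]
          continuous_on_const cont) auto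
  next
    have *: "continuous_on ({-e<..<e} \<times> cbox p q) (\<lambda>z. f (snd z))" if "continuous_on C f"
      for f :: "real^2 \<Rightarrow> real^3"
      using that box by (auto intro!: continuous_on_compose2[OF that] continuous_on_snd)
    show "continuous_on ({-e<..<e} \<times> cbox p q) (\<lambda>(t, u). L' t u)"
      unfolding L'_def split_beta using ne
      by (intro continuous_on_add continuous_on_mult continuous_on_powr continuous_on_norm
          continuous_on_inner continuous_on_scaleR[OF continuous_on_fst[OF continuous_on_id]]
          continuous_on_const *[OF cont(1)] *[OF cont(2)] *[OF cont(3)] *[OF cont(4)])
         (auto simp: box)
  qed (use e in auto)
  then have "((\<lambda>t. integral C (L t)) has_real_derivative integral C (L' 0)) (at 0)"
    using at_within_open[of 0 "{-e<..<e}"] e by (simp add: box)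
  then have "(E has_real_derivative integral C (L' 0)) (at 0)"
    by (rule has_field_derivative_transform_within_open[of _ _ _ "{-e<..<e}"]) (use e EL in auto)
  then have "integral C (L' 0) = 0" using E' by (rule DERIV_unique)
  moreover have "integral C (L' 0) = integral C (\<lambda>u. (N u \<bullet> m u) * norm (\<Phi> (x u)) powr \<alpha>
    + norm (?n u) * (\<alpha> * norm (\<Phi> (x u)) powr (\<alpha> - 2) * (\<Phi> (x u) \<bullet> (\<phi> u *\<^sub>R Z))))"
    by (rule integral_cong) (simp add: L'_def unit_normal_def powr_minus algebra_simps)
  ultimately show ?thesis by (simp only:)
qed

end

section \<open>The Euler-Lagrange equation\<close>

lemma integral_bump_product_deriv:
  fixes f :: "'a::euclidean_space \<Rightarrow> real"
  assumes "open V" "smooth_on V f" and r: "r > 0"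
    and box: "ball u\<^sub>0 (2 * r) \<subseteq> cbox p q" "cbox p q \<subseteq> V"
  shows "integral (cbox p q) (\<lambda>u. bump u\<^sub>0 r u * \<partial> f v u + \<partial> (bump u\<^sub>0 r) v u * f u) = 0"
proof -
  define g where "g u = bump u\<^sub>0 r u * f u" for u
  have bump: "smooth_on V (bump u\<^sub>0 r)" by (rule smooth_on_subset[OF smooth_on_bump subset_UNIV])
  have sub: "cball u\<^sub>0 r \<subseteq> ball u\<^sub>0 (2 * r)" using r by auto
  have "g u = 0" if "u \<in> - cball u\<^sub>0 r" for u
    using bump_eq_0[OF r, of u u\<^sub>0] that by (simp add: g_def)
  moreover have "smooth_on V g"
    unfolding g_def by (rule smooth_on_mult[OF assms(1) bump assms(2)])
  ultimately have "smooth_on (V \<union> - cball u\<^sub>0 r) g"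
    by (intro smooth_on_Un_zero[OF assms(1)]) auto
  moreover have "V \<union> - cball u\<^sub>0 r = UNIV" using sub box by blast
  ultimately have g: "smooth_on UNIV g" by simp
  have "integral (cbox p q) (\<partial> g v) = 0"
  proof (rule integral_dir_deriv_compact_support[OF _ _ _ r])
    show "g differentiable at u" for u by (rule smooth_on_differentiable[OF g]) simp
    show "continuous_on UNIV (\<partial> g v)"
      by (rule smooth_on_imp_continuous_on[OF smooth_on_dir_deriv[OF g]])
    fix u assume "g u \<noteq> 0"
    then have "u \<in> ball u\<^sub>0 r" using bump_eq_0[OF r] by (auto simp: g_def)
    then have "cball u r \<subseteq> ball u\<^sub>0 (2 * r)"
      by (auto simp: dist_norm) (metis (no_types) add.commute add_less_le_mono dist_norm dist_triangle
          mult_2 order_le_less_trans)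
    then show "cball u r \<subseteq> cbox p q" using box by blast
  qed
  moreover have "\<partial> g v u = bump u\<^sub>0 r u * \<partial> f v u + \<partial> (bump u\<^sub>0 r) v u * f u" if "u \<in> cbox p q" for u
    unfolding g_def using that box
    by (intro dir_deriv_mult smooth_on_differentiable[OF bump] smooth_on_differentiable[OF assms(2)]) auto
  ultimately show ?thesis by (metis (no_types, lifting) integral_cong)
qed

text \<open>
  If \<open>G u\<^sub>0 \<noteq> 0\<close>, then \<open>G\<close> has a strict sign on a box about \<open>u\<^sub>0\<close>, and a bump inside that box is
  not orthogonal to it.
\<close>
lemma fundamental_lemma_calculus_of_variations:
  fixes G :: "'a::euclidean_space \<Rightarrow> real"
  assumes "open V" "continuous_on V G" "u\<^sub>0 \<in> V"
    and orth: "\<And>p q r. r > 0 \<Longrightarrow> ball u\<^sub>0 (2 * r) \<subseteq> cbox p q \<Longrightarrow> cbox p q \<subseteq> V \<Longrightarrow>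
      integral (cbox p q) (\<lambda>u. bump u\<^sub>0 r u * G u) = 0"
  shows "G u\<^sub>0 = 0"
proof (rule ccontr)
  assume ne: "G u\<^sub>0 \<noteq> 0"
  define S where "S = V \<inter> (\<lambda>u. sgn (G u\<^sub>0) * G u) -` {0<..}"
  have "continuous_on V (\<lambda>u. sgn (G u\<^sub>0) * G u)"
    using assms(2) by (intro continuous_on_mult continuous_on_const)
  then have "open S"
    unfolding S_def by (intro continuous_open_preimage assms(1)) auto
  moreover have "u\<^sub>0 \<in> S"
    using ne assms(3) by (simp add: S_def sgn_mult_self_eq mult_sgn_abs[symmetric] zero_less_mult_iff sgn_real_def)
  ultimately obtain p q where pq: "u\<^sub>0 \<in> box p q" "cbox p q \<subseteq> S"
    using open_contains_cbox by metis
  obtain e where e: "e > 0" "ball u\<^sub>0 e \<subseteq> box p q"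
    using open_box pq(1) open_contains_ball by blast
  define r where "r = e / 2"
  have r: "r > 0" "ball u\<^sub>0 (2 * r) \<subseteq> cbox p q"
    using e box_subset_cbox[of p q] by (auto simp: r_def)
  have V: "cbox p q \<subseteq> V" and pos: "\<And>u. u \<in> cbox p q \<Longrightarrow> sgn (G u\<^sub>0) * G u > 0"
    using pq(2) by (auto simp: S_def)
  have "integral (cbox p q) (\<lambda>u. sgn (G u\<^sub>0) * (bump u\<^sub>0 r u * G u)) = 0"
    using orth[OF r V] by simp
  moreover have "continuous_on (cbox p q) (\<lambda>u. sgn (G u\<^sub>0) * (bump u\<^sub>0 r u * G u))"
    by (intro continuous_on_mult continuous_on_const continuous_on_subset[OF assms(2) V]
        continuous_on_subset[OF smooth_on_imp_continuous_on[OF smooth_on_bump] subset_UNIV])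
  moreover have "sgn (G u\<^sub>0) * (bump u\<^sub>0 r u * G u) \<ge> 0" if "u \<in> cbox p q" for u
    using mult_nonneg_nonneg[OF bump_nonneg[of u\<^sub>0 r u] less_imp_le[OF pos[OF that]]]
    by (simp add: mult_ac)
  moreover have u\<^sub>0: "u\<^sub>0 \<in> cbox p q" using pq(1) box_subset_cbox by blast
  moreover have "box p q \<noteq> {}" using pq(1) by blast
  ultimately have "sgn (G u\<^sub>0) * (bump u\<^sub>0 r u\<^sub>0 * G u\<^sub>0) = 0"
    using integral_cbox_eq_0_iff[of p q "\<lambda>u. sgn (G u\<^sub>0) * (bump u\<^sub>0 r u * G u)"] by blast
  moreover have "bump u\<^sub>0 r u\<^sub>0 > 0" using r(1) by (simp add: bump_pos_iff)
  ultimately show False using ne by (simp add: sgn_eq_0_iff)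
qed

context immersed_surface
begin

text \<open>
  The variation fields are \<open>\<phi> *\<^sub>R Z\<close> with the constant vector \<open>Z = N u\<^sub>0\<close>. Integration by parts turns
  the first variation into the integral of \<open>\<phi> * G\<close>, so \<open>G u\<^sub>0 = 0\<close>. Constancy of \<open>Z\<close> pays off at \<open>u\<^sub>0\<close>:
  there \<open>N u\<^sub>0\<close> is orthogonal to every vector product with the factor \<open>Z\<close>, so of the derivatives of
  \<open>f\<^sub>1\<close> and \<open>f\<^sub>2\<close> only the terms with a derivative of \<open>N\<close> survive, and these add up to the trace of the
  shape operator.
\<close>
theorem euler_lagrange:
  assumes stat: "stationary \<A> \<alpha> \<Phi>" and ne: "0 \<notin> range \<Phi>" and x: "(V, x) \<in> \<A>" and u\<^sub>0: "u\<^sub>0 \<in> V"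
  shows "mean_curvature (\<Phi> \<circ> x) u\<^sub>0 * (\<Phi> (x u\<^sub>0) \<bullet> \<Phi> (x u\<^sub>0))
    = \<alpha> * (\<Phi> (x u\<^sub>0) \<bullet> unit_normal (\<Phi> \<circ> x) u\<^sub>0)"
proof -
  interpret immersed_patch V "\<Phi> \<circ> x" by (rule immersed_patch[OF x])
  define Z where "Z = N u\<^sub>0"
  let ?\<Psi> = "\<Phi> \<circ> x" and ?e\<^sub>1 = "axis 1 1 :: real^2" and ?e\<^sub>2 = "axis 2 1 :: real^2"
  let ?\<Psi>\<^sub>1 = "\<partial> ?\<Psi> ?e\<^sub>1" and ?\<Psi>\<^sub>2 = "\<partial> ?\<Psi> ?e\<^sub>2" and ?n = "normal_vec ?\<Psi>"
  define w where "w u = norm (?\<Psi> u) powr \<alpha>" for u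
  define g\<^sub>1 where "g\<^sub>1 u = N u \<bullet> cross3 Z (?\<Psi>\<^sub>2 u)" for u
  define g\<^sub>2 where "g\<^sub>2 u = N u \<bullet> cross3 (?\<Psi>\<^sub>1 u) Z" for u
  define f\<^sub>1 where "f\<^sub>1 u = w u * g\<^sub>1 u" for u
  define f\<^sub>2 where "f\<^sub>2 u = w u * g\<^sub>2 u" for u
  define f\<^sub>0 where "f\<^sub>0 u = norm (?n u) * (\<alpha> * norm (?\<Psi> u) powr (\<alpha> - 2) * (?\<Psi> u \<bullet> Z))" for u
  define G where "G u = f\<^sub>0 u - \<partial> f\<^sub>1 ?e\<^sub>1 u - \<partial> f\<^sub>2 ?e\<^sub>2 u" for u
  have nz: "?\<Psi> u \<noteq> 0" for u using ne by (auto simp: image_iff)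
  have w: "smooth_on V w"
    unfolding w_def by (rule smooth_on_norm_powr[OF open_V smooth]) (rule nz)
  have g: "smooth_on V g\<^sub>1" "smooth_on V g\<^sub>2"
    unfolding g\<^sub>1_def g\<^sub>2_def
    by (rule smooth_on_inner[OF open_V smooth_N smooth_on_cross3[OF open_V smooth_on_const
            smooth_on_dir_deriv[OF smooth]]],
        rule smooth_on_inner[OF open_V smooth_N smooth_on_cross3[OF open_V
            smooth_on_dir_deriv[OF smooth] smooth_on_const]])
  have f: "smooth_on V f\<^sub>1" "smooth_on V f\<^sub>2"
    unfolding f\<^sub>1_def f\<^sub>2_def using smooth_on_mult[OF open_V w] g by auto
  have cont_f\<^sub>0: "continuous_on V f\<^sub>0"
    unfolding f\<^sub>0_def using nz
    by (intro continuous_on_mult continuous_on_norm continuous_on_powr continuous_on_inner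
        continuous_on_const smooth_on_imp_continuous_on[OF smooth]
        smooth_on_imp_continuous_on[OF smooth_normal_vec]) auto
  have cont_f: "continuous_on V f\<^sub>1" "continuous_on V f\<^sub>2"
    "continuous_on V (\<partial> f\<^sub>1 ?e\<^sub>1)" "continuous_on V (\<partial> f\<^sub>2 ?e\<^sub>2)"
    by (intro smooth_on_imp_continuous_on smooth_on_dir_deriv f)+
  have "G u\<^sub>0 = 0"
  proof (rule fundamental_lemma_calculus_of_variations[OF open_V _ u\<^sub>0])
    show "continuous_on V G"
      unfolding G_def by (intro continuous_on_diff cont_f\<^sub>0 cont_f)
    fix p q :: "real^2" and r :: real
    assume r: "r > 0" and box: "ball u\<^sub>0 (2 * r) \<subseteq> cbox p q" "cbox p q \<subseteq> V"
    define \<phi> where "\<phi> = bump u\<^sub>0 r"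
    interpret chart_variation \<A> \<Phi> V x "cbox p q" \<phi> Z
    proof
      fix u assume "u \<notin> cbox p q"
      then have "u \<notin> ball u\<^sub>0 r" using box(1) r by (auto simp: subset_iff)
      then show "\<phi> u = 0" unfolding \<phi>_def by (rule bump_eq_0[OF r])
    qed (use x box in \<open>auto simp: \<phi>_def smooth_on_bump compact_cbox\<close>)
    have cont_\<phi>: "continuous_on (cbox p q) \<phi>" "continuous_on (cbox p q) (\<partial> \<phi> v)" for v
      using smooth_on_imp_continuous_on[OF \<phi>(1)] smooth_on_imp_continuous_on[OF smooth_on_dir_deriv[OF \<phi>(1)]]
      by (auto intro: continuous_on_subset)
    note cont = continuous_on_subset[OF cont_f\<^sub>0 box(2)] cont_f[THEN continuous_on_subset, OF box(2)]
    have I: "integral (cbox p q) (\<lambda>u. \<phi> u * f\<^sub>0 u + \<partial> \<phi> ?e\<^sub>1 u * f\<^sub>1 u + \<partial> \<phi> ?e\<^sub>2 u * f\<^sub>2 u) = 0"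
    proof -
      have "(N u \<bullet> m u) * norm (\<Phi> (x u)) powr \<alpha> + norm (?n u) *
          (\<alpha> * norm (\<Phi> (x u)) powr (\<alpha> - 2) * (\<Phi> (x u) \<bullet> (\<phi> u *\<^sub>R Z)))
        = \<phi> u * f\<^sub>0 u + \<partial> \<phi> ?e\<^sub>1 u * f\<^sub>1 u + \<partial> \<phi> ?e\<^sub>2 u * f\<^sub>2 u" for u
        by (simp add: m_def f\<^sub>0_def f\<^sub>1_def f\<^sub>2_def g\<^sub>1_def g\<^sub>2_def w_def inner_add_right algebra_simps)
      then show ?thesis using first_variation[OF stat ne refl] by simp
    qed
    have I\<^sub>1: "integral (cbox p q) (\<lambda>u. \<phi> u * \<partial> f\<^sub>1 ?e\<^sub>1 u + \<partial> \<phi> ?e\<^sub>1 u * f\<^sub>1 u) = 0"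
      and I\<^sub>2: "integral (cbox p q) (\<lambda>u. \<phi> u * \<partial> f\<^sub>2 ?e\<^sub>2 u + \<partial> \<phi> ?e\<^sub>2 u * f\<^sub>2 u) = 0"
      unfolding \<phi>_def by (rule integral_bump_product_deriv[OF open_V _ r box] f)+
    have "(\<lambda>u. bump u\<^sub>0 r u * G u) = (\<lambda>u. (\<phi> u * f\<^sub>0 u + \<partial> \<phi> ?e\<^sub>1 u * f\<^sub>1 u + \<partial> \<phi> ?e\<^sub>2 u * f\<^sub>2 u)
        - (\<phi> u * \<partial> f\<^sub>1 ?e\<^sub>1 u + \<partial> \<phi> ?e\<^sub>1 u * f\<^sub>1 u) - (\<phi> u * \<partial> f\<^sub>2 ?e\<^sub>2 u + \<partial> \<phi> ?e\<^sub>2 u * f\<^sub>2 u))"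
      by (simp add: G_def \<phi>_def algebra_simps)
    moreover have int: "(\<lambda>u. \<phi> u * f\<^sub>0 u + \<partial> \<phi> ?e\<^sub>1 u * f\<^sub>1 u + \<partial> \<phi> ?e\<^sub>2 u * f\<^sub>2 u) integrable_on cbox p q"
      "(\<lambda>u. \<phi> u * \<partial> f\<^sub>1 ?e\<^sub>1 u + \<partial> \<phi> ?e\<^sub>1 u * f\<^sub>1 u) integrable_on cbox p q"
      "(\<lambda>u. \<phi> u * \<partial> f\<^sub>2 ?e\<^sub>2 u + \<partial> \<phi> ?e\<^sub>2 u * f\<^sub>2 u) integrable_on cbox p q"
      by (intro integrable_continuous continuous_on_add continuous_on_mult cont_\<phi> cont)+
    ultimately show "integral (cbox p q) (\<lambda>u. bump u\<^sub>0 r u * G u) = 0" using I I\<^sub>1 I\<^sub>2 integral_diff[OF integrable_diff[OF int(1,2)] int(3)] integral_diff[OF int(1,2)] by simp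
  qed
  moreover have "\<partial> f\<^sub>1 ?e\<^sub>1 u\<^sub>0 = - (w u\<^sub>0 * (Z \<bullet> cross3 (\<partial> N ?e\<^sub>1 u\<^sub>0) (?\<Psi>\<^sub>2 u\<^sub>0)))"
  proof -
    have "\<partial> (\<lambda>u. cross3 Z (?\<Psi>\<^sub>2 u)) ?e\<^sub>1 u\<^sub>0 = cross3 Z (\<partial> ?\<Psi>\<^sub>2 ?e\<^sub>1 u\<^sub>0)"
      using dir_deriv_cross3[OF differentiable_const differentiable_deriv[OF u\<^sub>0]] by simp
    then have "\<partial> g\<^sub>1 ?e\<^sub>1 u\<^sub>0 = \<partial> N ?e\<^sub>1 u\<^sub>0 \<bullet> cross3 Z (?\<Psi>\<^sub>2 u\<^sub>0)"
      unfolding g\<^sub>1_def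
      by (subst dir_deriv_inner[OF differentiable_N[OF u\<^sub>0] smooth_on_differentiable[OF
              smooth_on_cross3[OF open_V smooth_on_const smooth_on_dir_deriv[OF smooth]] u\<^sub>0]])
         (simp add: Z_def dot_cross_self)
    moreover have "g\<^sub>1 u\<^sub>0 = 0" by (simp add: g\<^sub>1_def Z_def dot_cross_self)
    ultimately show ?thesis
      unfolding f\<^sub>1_def
      by (subst dir_deriv_mult[OF smooth_on_differentiable[OF w u\<^sub>0] smooth_on_differentiable[OF g(1) u\<^sub>0]])
         (simp add: inner_cross3_swap(1)[of "\<partial> N ?e\<^sub>1 u\<^sub>0" Z])
  qed
  moreover have "\<partial> f\<^sub>2 ?e\<^sub>2 u\<^sub>0 = - (w u\<^sub>0 * (Z \<bullet> cross3 (?\<Psi>\<^sub>1 u\<^sub>0) (\<partial> N ?e\<^sub>2 u\<^sub>0)))"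
  proof -
    have "\<partial> (\<lambda>u. cross3 (?\<Psi>\<^sub>1 u) Z) ?e\<^sub>2 u\<^sub>0 = cross3 (\<partial> ?\<Psi>\<^sub>1 ?e\<^sub>2 u\<^sub>0) Z"
      using dir_deriv_cross3[OF differentiable_deriv[OF u\<^sub>0] differentiable_const] by simp
    then have "\<partial> g\<^sub>2 ?e\<^sub>2 u\<^sub>0 = \<partial> N ?e\<^sub>2 u\<^sub>0 \<bullet> cross3 (?\<Psi>\<^sub>1 u\<^sub>0) Z"
      unfolding g\<^sub>2_def
      by (subst dir_deriv_inner[OF differentiable_N[OF u\<^sub>0] smooth_on_differentiable[OF
              smooth_on_cross3[OF open_V smooth_on_dir_deriv[OF smooth] smooth_on_const] u\<^sub>0]])
         (simp add: Z_def dot_cross_self)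
    moreover have "g\<^sub>2 u\<^sub>0 = 0" by (simp add: g\<^sub>2_def Z_def dot_cross_self)
    ultimately show ?thesis
      unfolding f\<^sub>2_def
      by (subst dir_deriv_mult[OF smooth_on_differentiable[OF w u\<^sub>0] smooth_on_differentiable[OF g(2) u\<^sub>0]])
         (simp add: inner_cross3_swap(2)[of "\<partial> N ?e\<^sub>2 u\<^sub>0" _ Z])
  qed
  ultimately have "f\<^sub>0 u\<^sub>0 + w u\<^sub>0 *
      (Z \<bullet> (cross3 (\<partial> N ?e\<^sub>1 u\<^sub>0) (?\<Psi>\<^sub>2 u\<^sub>0) + cross3 (?\<Psi>\<^sub>1 u\<^sub>0) (\<partial> N ?e\<^sub>2 u\<^sub>0))) = 0"
    by (simp add: G_def inner_add_right algebra_simps)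
  moreover have "Z \<bullet> ?n u\<^sub>0 = norm (?n u\<^sub>0)"
    using normal_vec_eq[OF u\<^sub>0] inner_N_N[OF u\<^sub>0] by (metis Z_def inner_scaleR_right mult.right_neutral)
  ultimately have "norm (?n u\<^sub>0) * (\<alpha> * norm (?\<Psi> u\<^sub>0) powr (\<alpha> - 2) * (?\<Psi> u\<^sub>0 \<bullet> Z))
      = norm (?n u\<^sub>0) * (w u\<^sub>0 * mean_curvature ?\<Psi> u\<^sub>0)"
    unfolding mean_curvature_cross3[OF u\<^sub>0] normal_vec_def[symmetric]
    by (simp add: f\<^sub>0_def algebra_simps)
  then have "\<alpha> * norm (?\<Psi> u\<^sub>0) powr (\<alpha> - 2) * (?\<Psi> u\<^sub>0 \<bullet> Z) = w u\<^sub>0 * mean_curvature ?\<Psi> u\<^sub>0"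
    using normal_vec_nonzero[OF u\<^sub>0] by (simp only: mult_left_cancel norm_eq_zero simp_thms)
  moreover have "w u\<^sub>0 = norm (?\<Psi> u\<^sub>0) powr (\<alpha> - 2) * (?\<Psi> u\<^sub>0 \<bullet> ?\<Psi> u\<^sub>0)"
    using nz[of u\<^sub>0] by (simp add: w_def powr_diff dot_square_norm powr_numeral)
  moreover have "norm (?\<Psi> u\<^sub>0) powr (\<alpha> - 2) \<noteq> 0" using nz[of u\<^sub>0] by simp
  ultimately have "norm (?\<Psi> u\<^sub>0) powr (\<alpha> - 2) * (mean_curvature ?\<Psi> u\<^sub>0 * (?\<Psi> u\<^sub>0 \<bullet> ?\<Psi> u\<^sub>0))
      = norm (?\<Psi> u\<^sub>0) powr (\<alpha> - 2) * (\<alpha> * (?\<Psi> u\<^sub>0 \<bullet> Z))"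
    by (simp add: algebra_simps)
  then show ?thesis
    using \<open>norm (?\<Psi> u\<^sub>0) powr (\<alpha> - 2) \<noteq> 0\<close> by (simp add: Z_def)
qed

end

section \<open>Local rigidity\<close>

locale stationary_patch = immersed_patch +
  fixes c \<alpha> :: real
  assumes \<alpha>_nonzero: "\<alpha> \<noteq> 0"
    and nonzero: "u \<in> V \<Longrightarrow> \<Psi> u \<noteq> 0"
    and stationary_eq: "u \<in> V \<Longrightarrow> c * (\<Psi> u \<bullet> \<Psi> u) = \<alpha> * (\<Psi> u \<bullet> N u)"
    and mean_curvature_eq: "u \<in> V \<Longrightarrow> mean_curvature \<Psi> u = c"
begin

text \<open>
  The support function \<open>h\<close> and the tangential part \<open>P\<close> of the position vector. Where \<open>P\<close> does not
  vanish, \<open>\<kappa>\<^sub>2\<close> turns out to be the principal curvature in the direction orthogonal to \<open>P\<close>, and \<open>k\<close> its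
  excess over the principal curvature in the direction of \<open>P\<close>.
\<close>
definition h :: "real^2 \<Rightarrow> real" where "h u = \<Psi> u \<bullet> N u"

definition P :: "real^2 \<Rightarrow> real^3" where "P u = \<Psi> u - h u *\<^sub>R N u"

definition \<kappa>\<^sub>2 :: real where "\<kappa>\<^sub>2 = c + 2 * c / \<alpha>"

definition k :: real where "k = c + 4 * c / \<alpha>"

lemma smooth_h: "smooth_on V h"
  unfolding h_def by (rule smooth_on_inner[OF open_V smooth smooth_N])

lemma smooth_P: "smooth_on V P"
  unfolding P_def
  by (rule smooth_on_diff[OF open_V smooth smooth_on_scaleR[OF open_V smooth_h smooth_N]])

lemma inner_P_N: "u \<in> V \<Longrightarrow> P u \<bullet> N u = 0"
  by (simp add: P_def h_def inner_diff_left inner_N_N)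

lemma inner_P_deriv: "u \<in> V \<Longrightarrow> P u \<bullet> \<partial> \<Psi> v u = \<Psi> u \<bullet> \<partial> \<Psi> v u"
  by (simp add: P_def inner_diff_left inner_deriv_N inner_commute[of "N u"])

lemma inner_P_dN: "u \<in> V \<Longrightarrow> P u \<bullet> \<partial> N v u = \<Psi> u \<bullet> \<partial> N v u"
  by (simp add: P_def inner_diff_left inner_dN_N inner_commute[of "N u"])

lemma inner_P_P: "u \<in> V \<Longrightarrow> P u \<bullet> P u = \<Psi> u \<bullet> \<Psi> u - h u * h u"
  by (simp add: P_def h_def inner_diff_left inner_diff_right inner_N_N inner_commute algebra_simps)

lemma deriv_h: "u \<in> V \<Longrightarrow> \<partial> h v u = P u \<bullet> \<partial> N v u"
  using dir_deriv_inner[OF differentiable differentiable_N]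
  by (simp add: h_def[abs_def] inner_deriv_N inner_P_dN)

lemma deriv_norm_squared: "u \<in> V \<Longrightarrow> \<partial> (\<lambda>u. \<Psi> u \<bullet> \<Psi> u) v u = 2 * (P u \<bullet> \<partial> \<Psi> v u)"
  using dir_deriv_inner[OF differentiable differentiable]
  by (simp add: inner_P_deriv inner_commute)

lemma stationary_deriv:
  assumes u: "u \<in> V"
  shows "2 * c * (P u \<bullet> \<partial> \<Psi> v u) = \<alpha> * \<partial> h v u"
proof -
  have "\<partial> (\<lambda>u. c * (\<Psi> u \<bullet> \<Psi> u)) v u = \<partial> (\<lambda>u. \<alpha> * h u) v u"
    using stationary_eq
    by (intro dir_deriv_cong[OF open_V u] smooth_on_differentiable[OF smooth_on_mult[OF open_V
            smooth_on_const smooth_on_inner[OF open_V smooth smooth]] u]) (simp add: h_def)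
  moreover have "\<partial> (\<lambda>u. c * (\<Psi> u \<bullet> \<Psi> u)) v u = c * \<partial> (\<lambda>u. \<Psi> u \<bullet> \<Psi> u) v u"
    by (rule dir_deriv_bounded_linear[OF bounded_linear_mult_right
          smooth_on_differentiable[OF smooth_on_inner[OF open_V smooth smooth] u]])
  moreover have "\<partial> (\<lambda>u. \<alpha> * h u) v u = \<alpha> * \<partial> h v u"
    by (rule dir_deriv_bounded_linear[OF bounded_linear_mult_right smooth_on_differentiable[OF smooth_h u]])
  ultimately show ?thesis by (simp add: deriv_norm_squared[OF u])
qed

text \<open>
  The derivative of the stationarity equation says that the tangential part \<open>P\<close> of the position
  vector, where it does not vanish, is an eigenvector of the shape operator for the eigenvalue \<open>- 2 * c / \<alpha>\<close>. As the trace is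
  \<open>c\<close>, the direction orthogonal to \<open>P\<close> has the eigenvalue \<open>\<kappa>\<^sub>2\<close>.
\<close>
lemma principal_frame:
  assumes u: "u \<in> V"
  obtains p q where "\<partial> \<Psi> p u = P u" "\<partial> N p u = (2 * c / \<alpha>) *\<^sub>R P u"
    "\<partial> \<Psi> q u = cross3 (N u) (P u)" "P u \<noteq> 0 \<Longrightarrow> \<partial> N q u = - \<kappa>\<^sub>2 *\<^sub>R \<partial> \<Psi> q u"
proof -
  obtain p where p: "\<partial> \<Psi> p u = P u"
    using tangent_iff[OF u, of "P u"] inner_P_N[OF u] by auto
  obtain q where q: "\<partial> \<Psi> q u = cross3 (N u) (P u)"
    using tangent_iff[OF u, of "cross3 (N u) (P u)"] by (auto simp: dot_cross_self)
  \<comment> \<open>\<open>W\<close> is tangential and orthogonal to all tangent vectors, hence zero.\<close>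
  define W where "W = \<partial> N p u - (2 * c / \<alpha>) *\<^sub>R P u"
  have "W \<bullet> \<partial> \<Psi> v u = 0" for v
  proof -
    have "W \<bullet> \<partial> \<Psi> v u = \<partial> h v u - 2 * c / \<alpha> * (P u \<bullet> \<partial> \<Psi> v u)"
      using dN_symmetric[OF u, of p v]
      by (simp add: W_def inner_diff_left p deriv_h[OF u] inner_commute[of "\<partial> N v u" "P u"])
    then show ?thesis
      using stationary_deriv[OF u, of v] \<alpha>_nonzero by (simp add: field_simps)
  qed
  moreover obtain z where "W = \<partial> \<Psi> z u"
    using tangent_iff[OF u, of W] by (auto simp: W_def inner_diff_left inner_dN_N[OF u] inner_P_N[OF u])
  ultimately have "W \<bullet> W = 0" by metis
  then have Np: "\<partial> N p u = (2 * c / \<alpha>) *\<^sub>R P u" by (simp add: W_def)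
  have PX: "P u \<bullet> \<partial> \<Psi> q u = 0" unfolding q by (simp add: dot_cross_self)
  define Y where "Y = \<partial> N q u + \<kappa>\<^sub>2 *\<^sub>R \<partial> \<Psi> q u"
  have "P u \<bullet> Y = 0"
    using dN_symmetric[OF u, of q p] PX by (simp add: Y_def inner_add_right p Np inner_commute)
  moreover have "cross3 (P u) Y = 0"
    using mean_curvature_cross3[OF u, of p q]
    by (simp add: Y_def \<kappa>\<^sub>2_def p Np mean_curvature_eq[OF u] cross3_bilinear
        eq_neg_iff_add_eq_0 algebra_simps)
  ultimately have "P u = 0 \<or> Y = 0" using norm_and_cross_eq_0 by blast
  then have "P u \<noteq> 0 \<Longrightarrow> \<partial> N q u = - \<kappa>\<^sub>2 *\<^sub>R \<partial> \<Psi> q u"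
    by (auto simp: Y_def eq_neg_iff_add_eq_0)
  then show thesis using that p Np q by blast
qed

text \<open>
  With the second principal curvature \<open>\<kappa>\<^sub>2\<close> constant, the derivative of \<open>N + \<kappa>\<^sub>2 *\<^sub>R \<Psi>\<close> has rank at
  most one where \<open>P \<noteq> 0\<close>: it vanishes orthogonally to \<open>P\<close>.
\<close>
lemma deriv_N_plus:
  assumes u: "u \<in> V"
  shows "(P u \<bullet> P u) *\<^sub>R (\<partial> N v u + \<kappa>\<^sub>2 *\<^sub>R \<partial> \<Psi> v u) = (k * (P u \<bullet> \<partial> \<Psi> v u)) *\<^sub>R P u"
proof (cases "P u = 0")
  case False
  obtain p q where pq: "\<partial> \<Psi> p u = P u" "\<partial> N p u = (2 * c / \<alpha>) *\<^sub>R P u"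
    "\<partial> \<Psi> q u = cross3 (N u) (P u)" "\<partial> N q u = - \<kappa>\<^sub>2 *\<^sub>R \<partial> \<Psi> q u"
    using principal_frame[OF u] False by metis
  define a where "a = P u \<bullet> \<partial> \<Psi> v u"
  define X where "X = cross3 (N u) (P u)"
  define b where "b = X \<bullet> \<partial> \<Psi> v u"
  have PX: "P u \<bullet> X = 0" "X \<bullet> P u = 0" by (simp_all add: X_def dot_cross_self)
  have n: "cross3 (P u) X = (P u \<bullet> P u) *\<^sub>R N u"
    by (simp add: X_def Lagrange inner_P_N[OF u])
  have XX: "X \<bullet> X = P u \<bullet> P u"
    by (simp add: X_def dot_cross inner_N_N[OF u] inner_P_N[OF u] inner_commute[of "N u" "P u"])
  have "(P u \<bullet> P u) *\<^sub>R ((P u \<bullet> P u) *\<^sub>R \<partial> \<Psi> v u) = (P u \<bullet> P u) *\<^sub>R (a *\<^sub>R P u + b *\<^sub>R X)"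
  proof -
    have "cross3 (P u) X \<bullet> cross3 (P u) X = (P u \<bullet> P u) * (P u \<bullet> P u)"
      unfolding n by (simp add: inner_N_N[OF u])
    moreover have "cross3 (\<partial> \<Psi> v u) X \<bullet> cross3 (P u) X = a * (P u \<bullet> P u)"
      "cross3 (P u) (\<partial> \<Psi> v u) \<bullet> cross3 (P u) X = b * (P u \<bullet> P u)"
      by (simp_all add: dot_cross XX PX a_def b_def inner_commute[of "\<partial> \<Psi> v u"])
    moreover have "\<partial> \<Psi> v u \<bullet> cross3 (P u) X = 0"
      unfolding n by (simp add: inner_deriv_N[OF u])
    ultimately show ?thesis
      using cross3_frame_expand[of "P u" X "\<partial> \<Psi> v u"] by (simp add: algebra_simps)
  qed
  then have "(P u \<bullet> P u) *\<^sub>R \<partial> \<Psi> v u = a *\<^sub>R P u + b *\<^sub>R X"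
    using False by (simp only: scaleR_cancel_left inner_eq_zero_iff simp_thms)
  then have "\<partial> \<Psi> ((P u \<bullet> P u) *\<^sub>R v) u = \<partial> \<Psi> (a *\<^sub>R p + b *\<^sub>R q) u"
    using linear_deriv[OF u] by (simp add: linear_add linear_scale pq(1,3) X_def)
  then have v: "(P u \<bullet> P u) *\<^sub>R v = a *\<^sub>R p + b *\<^sub>R q"
    using inj_deriv[OF u] by (simp add: inj_eq)
  have "(P u \<bullet> P u) *\<^sub>R (\<partial> N v u + \<kappa>\<^sub>2 *\<^sub>R \<partial> \<Psi> v u)
      = \<partial> N ((P u \<bullet> P u) *\<^sub>R v) u + \<kappa>\<^sub>2 *\<^sub>R \<partial> \<Psi> ((P u \<bullet> P u) *\<^sub>R v) u"
    using linear_deriv[OF u] linear_dN[OF u] by (simp add: linear_scale scaleR_add_right)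
  also have "\<dots> = a *\<^sub>R (\<partial> N p u + \<kappa>\<^sub>2 *\<^sub>R \<partial> \<Psi> p u) + b *\<^sub>R (\<partial> N q u + \<kappa>\<^sub>2 *\<^sub>R \<partial> \<Psi> q u)"
    unfolding v using linear_deriv[OF u] linear_dN[OF u]
    by (simp add: linear_add linear_scale algebra_simps)
  also have "\<dots> = a *\<^sub>R ((2 * c / \<alpha> + \<kappa>\<^sub>2) *\<^sub>R P u)"
    by (simp add: pq(1,2,4) scaleR_add_left)
  also have "2 * c / \<alpha> + \<kappa>\<^sub>2 = k"
    using \<alpha>_nonzero by (simp add: k_def \<kappa>\<^sub>2_def field_simps)
  also have "a *\<^sub>R (k *\<^sub>R P u) = (k * a) *\<^sub>R P u" by (simp add: mult.commute)
  finally show ?thesis by (simp add: a_def)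
qed simp

text \<open>
  The identity above holds on all of \<open>V\<close>, so it can be differentiated. Doing this for the principal
  directions \<open>p\<close> and \<open>q\<close> in both orders and using the symmetry of the second derivatives (this
  is where the Codazzi equations enter), only \<open>\<partial> P q = 0\<close> remains. The left-hand side is
  \<open>(1 + h * \<kappa>\<^sub>2) *\<^sub>R \<partial> \<Psi> q\<close>, since \<open>h\<close> is stationary in the direction \<open>q\<close>.
\<close>
lemma support_times_curvature:
  assumes k: "k \<noteq> 0" and u: "u \<in> V" and P: "P u \<noteq> 0"
  shows "1 + h u * \<kappa>\<^sub>2 = 0"
proof -
  obtain p q where pq: "\<partial> \<Psi> p u = P u" "\<partial> N p u = (2 * c / \<alpha>) *\<^sub>R P u"
    "\<partial> \<Psi> q u = cross3 (N u) (P u)" "\<partial> N q u = - \<kappa>\<^sub>2 *\<^sub>R \<partial> \<Psi> q u"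
    using principal_frame[OF u] P by metis
  define A where "A z = N z + \<kappa>\<^sub>2 *\<^sub>R \<Psi> z" for z
  define \<rho> where "\<rho> z = (1 / 2) * (\<Psi> z \<bullet> \<Psi> z)" for z
  define B where "B z = P z \<bullet> P z" for z
  have A: "smooth_on V A"
    unfolding A_def
    by (rule smooth_on_add[OF open_V smooth_N smooth_on_scaleR[OF open_V smooth_on_const smooth]])
  have \<rho>: "smooth_on V \<rho>"
    unfolding \<rho>_def
    by (rule smooth_on_mult[OF open_V smooth_on_const smooth_on_inner[OF open_V smooth smooth]])
  have B: "smooth_on V B"
    unfolding B_def by (rule smooth_on_inner[OF open_V smooth_P smooth_P])
  have A': "\<partial> A v z = \<partial> N v z + \<kappa>\<^sub>2 *\<^sub>R \<partial> \<Psi> v z" if z: "z \<in> V" for v z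
  proof -
    have "\<partial> A v z = \<partial> N v z + \<partial> (\<lambda>z. \<kappa>\<^sub>2 *\<^sub>R \<Psi> z) v z"
      unfolding A_def
      by (rule dir_deriv_add[OF differentiable_N[OF z] smooth_on_differentiable[OF
              smooth_on_scaleR[OF open_V smooth_on_const smooth] z]])
    then show ?thesis
      by (simp add: dir_deriv_bounded_linear[OF bounded_linear_scaleR_right differentiable[OF z]])
  qed
  have \<rho>': "\<partial> \<rho> v z = P z \<bullet> \<partial> \<Psi> v z" if z: "z \<in> V" for v z
    unfolding \<rho>_def
    using dir_deriv_bounded_linear[OF bounded_linear_mult_right[of "1/2"]
        smooth_on_differentiable[OF smooth_on_inner[OF open_V smooth smooth] z]]
    by (simp add: deriv_norm_squared[OF z])
  have h': "\<partial> h v u = (2 * c / \<alpha>) * \<partial> \<rho> v u" for v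
    using stationary_deriv[OF u, of v] \<alpha>_nonzero by (simp add: \<rho>'[OF u] field_simps)
  have \<rho>q: "\<partial> \<rho> q u = 0" by (simp add: \<rho>'[OF u] pq(3) dot_cross_self)
  have \<rho>p: "\<partial> \<rho> p u \<noteq> 0" using P by (simp add: \<rho>'[OF u] pq(1))
  have Aq: "\<partial> A q u = 0" by (simp add: A'[OF u] pq(4))
  have Bq: "\<partial> B q u = 0"
  proof -
    have "\<partial> B q u = \<partial> (\<lambda>z. 2 * \<rho> z - h z * h z) q u"
      by (rule dir_deriv_cong[OF open_V u _ smooth_on_differentiable[OF B u]])
         (simp add: B_def inner_P_P \<rho>_def)
    also have "\<dots> = \<partial> (\<lambda>z. 2 * \<rho> z) q u - \<partial> (\<lambda>z. h z * h z) q u"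
      by (rule dir_deriv_diff[OF
            smooth_on_differentiable[OF smooth_on_mult[OF open_V smooth_on_const \<rho>] u]
            smooth_on_differentiable[OF smooth_on_mult[OF open_V smooth_h smooth_h] u]])
    also have "\<dots> = 0"
      using h'[of q] \<rho>q
      by (simp add: dir_deriv_bounded_linear[OF bounded_linear_mult_right smooth_on_differentiable[OF \<rho> u]]
          dir_deriv_mult[OF smooth_on_differentiable[OF smooth_h u] smooth_on_differentiable[OF smooth_h u]])
    finally show ?thesis .
  qed
  have deriv: "B u *\<^sub>R \<partial> (\<partial> A v) w u + \<partial> B w u *\<^sub>R \<partial> A v u
      = k *\<^sub>R (\<partial> \<rho> v u *\<^sub>R \<partial> P w u + \<partial> (\<partial> \<rho> v) w u *\<^sub>R P u)" for v w
  proof -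
    have "\<partial> (\<lambda>z. B z *\<^sub>R \<partial> A v z) w u = \<partial> (\<lambda>z. k *\<^sub>R (\<partial> \<rho> v z *\<^sub>R P z)) w u"
      by (rule dir_deriv_cong[OF open_V u _ smooth_on_differentiable[OF
              smooth_on_scaleR[OF open_V B smooth_on_dir_deriv[OF A]] u]])
         (simp add: A' \<rho>' B_def deriv_N_plus)
    moreover have "\<partial> (\<lambda>z. k *\<^sub>R (\<partial> \<rho> v z *\<^sub>R P z)) w u = k *\<^sub>R \<partial> (\<lambda>z. \<partial> \<rho> v z *\<^sub>R P z) w u"
      by (rule dir_deriv_bounded_linear[OF bounded_linear_scaleR_right smooth_on_differentiable[OF
              smooth_on_scaleR[OF open_V smooth_on_dir_deriv[OF \<rho>] smooth_P] u]])
    ultimately show ?thesis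
      by (simp add: dir_deriv_scaleR[OF smooth_on_differentiable[OF B u]
            smooth_on_differentiable[OF smooth_on_dir_deriv[OF A] u]]
          dir_deriv_scaleR[OF smooth_on_differentiable[OF smooth_on_dir_deriv[OF \<rho>] u]
            smooth_on_differentiable[OF smooth_P u]])
  qed
  have "\<partial> \<rho> p u *\<^sub>R \<partial> P q u = 0"
    using deriv[of p q] deriv[of q p] k
    by (simp add: Bq Aq \<rho>q dir_deriv_commute[OF open_V A u, of p q]
        dir_deriv_commute[OF open_V \<rho> u, of p q] scaleR_add_right)
  then have "\<partial> P q u = 0" using \<rho>p by simp
  moreover have "\<partial> P q u = \<partial> \<Psi> q u - (h u *\<^sub>R \<partial> N q u + \<partial> h q u *\<^sub>R N u)"
    unfolding P_def
    by (simp add: dir_deriv_diff[OF differentiable[OF u] smooth_on_differentiable[OF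
            smooth_on_scaleR[OF open_V smooth_h smooth_N] u]]
        dir_deriv_scaleR[OF smooth_on_differentiable[OF smooth_h u] differentiable_N[OF u]])
  ultimately have "(1 + h u * \<kappa>\<^sub>2) *\<^sub>R \<partial> \<Psi> q u = 0"
    by (simp add: h' \<rho>q pq(4) algebra_simps)
  moreover have "\<partial> \<Psi> q u \<noteq> 0"
    using P inner_P_N[OF u] inner_N_N[OF u] norm_and_cross_eq_0[of "N u" "P u"]
    unfolding pq(3) by (auto simp: inner_commute)
  ultimately show ?thesis by simp
qed

lemma open_P_nonzero: "open {u \<in> V. P u \<noteq> 0}"
proof -
  have "open (V \<inter> P -` (- {0}))"
    by (intro continuous_open_preimage smooth_on_imp_continuous_on[OF smooth_P] open_V) auto
  moreover have "V \<inter> P -` (- {0}) = {u \<in> V. P u \<noteq> 0}" by auto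
  ultimately show ?thesis by simp
qed

text \<open>
  Where \<open>P \<noteq> 0\<close> the preceding lemma fixes the value of \<open>h\<close>, so \<open>h\<close> is locally constant; but by the
  stationarity equation its derivative in the direction of \<open>P\<close> is a nonzero multiple of \<open>P \<bullet> P\<close>.
\<close>
theorem position_normal:
  assumes k: "k \<noteq> 0" and u: "u \<in> V"
  shows "P u = 0"
proof (rule ccontr)
  assume P: "P u \<noteq> 0"
  have c: "c \<noteq> 0" using k by (auto simp: k_def)
  have "h z = - 1 / \<kappa>\<^sub>2" if "z \<in> {u \<in> V. P u \<noteq> 0}" for z
    using support_times_curvature[OF k, of z] that
    by (cases "\<kappa>\<^sub>2 = 0") (auto simp: field_simps add_eq_0_iff)
  then have "\<partial> h v u = 0" for v
    using P u by (intro dir_deriv_locally_const[OF open_P_nonzero]) auto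
  then have "P u \<bullet> \<partial> \<Psi> v u = 0" for v
    using stationary_deriv[OF u, of v] c by simp
  then show False
    using P tangent_iff[OF u, of "P u"] inner_P_N[OF u] by (metis inner_eq_zero_iff)
qed

text \<open>
  Where \<open>P \<noteq> 0\<close>, the claim is \<open>deriv_N_plus\<close>. By continuity, a point violating it has a neighbourhood
  with \<open>P = 0\<close>, which lies on a sphere of radius \<open>\<bar>h\<bar>\<close> about the origin. The mean curvature of that
  sphere gives \<open>c * h = - 2\<close>, whereas the stationarity equation gives \<open>c * h = \<alpha>\<close>, so that \<open>c \<noteq> 0\<close>
  and \<open>\<alpha> = - 4\<close> by \<open>k = 0\<close>.
\<close>
theorem umbilic:
  assumes k: "k = 0" and u: "u \<in> V"
  shows "\<partial> N v u + \<kappa>\<^sub>2 *\<^sub>R \<partial> \<Psi> v u = 0"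
proof (rule ccontr)
  define A where "A z = \<partial> N v z + \<kappa>\<^sub>2 *\<^sub>R \<partial> \<Psi> v z" for z
  assume "\<partial> N v u + \<kappa>\<^sub>2 *\<^sub>R \<partial> \<Psi> v u \<noteq> 0"
  then have Au: "A u \<noteq> 0" by (simp add: A_def)
  define S where "S = V \<inter> A -` (- {0})"
  have "continuous_on V A"
    unfolding A_def
    by (intro continuous_on_add continuous_on_scaleR continuous_on_const
        smooth_on_imp_continuous_on[OF smooth_on_dir_deriv[OF smooth_N]]
        smooth_on_imp_continuous_on[OF smooth_on_dir_deriv[OF smooth]])
  then have S: "open S" unfolding S_def by (intro continuous_open_preimage open_V) auto
  have uS: "u \<in> S" using u Au by (simp add: S_def)
  have P0: "P z = 0" if "z \<in> S" for z
    using deriv_N_plus[of z v] k that by (auto simp: S_def A_def)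
  have \<Psi>u: "\<Psi> u = h u *\<^sub>R N u" using P0[OF uS] by (simp add: P_def)
  then have h0: "h u \<noteq> 0" using nonzero[OF u] by auto
  have "c * (h u * h u) = \<alpha> * h u"
    using stationary_eq[OF u] unfolding \<Psi>u by (simp add: inner_N_N[OF u])
  then have ch: "c * h u = \<alpha>" using h0 by simp
  then have "c \<noteq> 0" using \<alpha>_nonzero by auto
  moreover have "c * (\<alpha> + 4) = 0" using k \<alpha>_nonzero by (simp add: k_def field_simps)
  ultimately have "\<alpha> + 4 = 0" by simp
  have "\<partial> h w u = 0" for w
    using stationary_deriv[OF u, of w] P0[OF uS] \<alpha>_nonzero by simp
  moreover have "\<partial> P w u = 0" for w
    by (rule dir_deriv_locally_const[OF S uS P0])
  moreover have "\<partial> P w u = \<partial> \<Psi> w u - (h u *\<^sub>R \<partial> N w u + \<partial> h w u *\<^sub>R N u)" for w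
    unfolding P_def
    by (simp add: dir_deriv_diff[OF differentiable[OF u] smooth_on_differentiable[OF
            smooth_on_scaleR[OF open_V smooth_h smooth_N] u]]
        dir_deriv_scaleR[OF smooth_on_differentiable[OF smooth_h u] differentiable_N[OF u]])
  ultimately have \<Psi>N: "h u *\<^sub>R \<partial> N w u = \<partial> \<Psi> w u" for w by simp
  let ?n = "normal_vec \<Psi> u"
  have "h u *\<^sub>R (cross3 (\<partial> N (axis 1 1) u) (\<partial> \<Psi> (axis 2 1) u)
      + cross3 (\<partial> \<Psi> (axis 1 1) u) (\<partial> N (axis 2 1) u)) = 2 *\<^sub>R ?n"
  proof -
    have "h u *\<^sub>R cross3 (\<partial> N (axis 1 1) u) (\<partial> \<Psi> (axis 2 1) u) = ?n"
      by (simp only: cross_mult_left[symmetric] \<Psi>N normal_vec_def)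
    moreover have "h u *\<^sub>R cross3 (\<partial> \<Psi> (axis 1 1) u) (\<partial> N (axis 2 1) u) = ?n"
      by (simp only: cross_mult_right[symmetric] \<Psi>N normal_vec_def)
    ultimately show ?thesis by (simp add: scaleR_add_right scaleR_2)
  qed
  then have "(- (c * h u)) *\<^sub>R ?n = 2 *\<^sub>R ?n"
    unfolding mean_curvature_cross3[OF u] mean_curvature_eq[OF u] normal_vec_def[symmetric]
    by (simp add: mult.commute)
  then have "c * h u = - 2"
    using normal_vec_nonzero[OF u] by (simp only: scaleR_cancel_right) simp
  then show False using ch \<open>\<alpha> + 4 = 0\<close> by simp
qed

end

section \<open>Global rigidity\<close>

context immersed_surface
begin

text \<open>
  A change of chart multiplies the normal vector by the Jacobian determinant of the transition map,
  which is positive for an oriented atlas.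
\<close>
lemma unit_normal_transition:
  assumes x: "(V, x) \<in> \<A>" and y: "(W, y) \<in> \<A>" and u: "u \<in> V" and w: "w \<in> W" and eq: "x u = y w"
  shows "unit_normal (\<Phi> \<circ> y) w = unit_normal (\<Phi> \<circ> x) u"
proof -
  interpret X: immersed_patch V "\<Phi> \<circ> x" by (rule immersed_patch[OF x])
  let ?\<tau> = "inv_into V x \<circ> y" and ?T = "W \<inter> y -` (x ` V)"
  have wT: "w \<in> ?T" using w u eq by (metis IntI image_eqI vimageI)
  have \<tau>w: "?\<tau> w = u" using chart_inverse[OF x u] eq by simp
  let ?D = "frechet_derivative ?\<tau> (at w)"
  have "(\<Phi> \<circ> x has_derivative (\<lambda>v. \<partial> (\<Phi> \<circ> x) v u)) (at (?\<tau> w))"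
    unfolding \<tau>w by (rule smooth_on_has_derivative[OF X.smooth u])
  with smooth_on_has_derivative[OF transition_smooth[OF x y] wT]
  have "((\<lambda>w. (\<Phi> \<circ> x) (?\<tau> w)) has_derivative (\<lambda>v. \<partial> (\<Phi> \<circ> x) (?D v) u)) (at w)"
    by (rule has_derivative_compose)
  then have "(\<Phi> \<circ> y has_derivative (\<lambda>v. \<partial> (\<Phi> \<circ> x) (?D v) u)) (at w)"
    by (rule has_derivative_transform_within_open[OF _ transition_domain_open[OF x y] wT])
       (auto simp: f_inv_into_f)
  then have "normal_vec (\<Phi> \<circ> y) w
      = cross3 (\<partial> (\<Phi> \<circ> x) (?D (axis 1 1)) u) (\<partial> (\<Phi> \<circ> x) (?D (axis 2 1)) u)"
    by (simp add: normal_vec_def dir_deriv_eqI)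
  also have "\<dots> = (?D (axis 1 1) $ 1 * ?D (axis 2 1) $ 2 - ?D (axis 1 1) $ 2 * ?D (axis 2 1) $ 1)
      *\<^sub>R normal_vec (\<Phi> \<circ> x) u"
    unfolding normal_vec_def by (rule cross3_linear_image[OF X.linear_deriv[OF u]])
  also have "?D (axis 1 1) $ 1 * ?D (axis 2 1) $ 2 - ?D (axis 1 1) $ 2 * ?D (axis 2 1) $ 1
      = det (matrix ?D)"
    by (simp add: det_2 matrix_def mult.commute)
  finally have n: "normal_vec (\<Phi> \<circ> y) w = det (matrix ?D) *\<^sub>R normal_vec (\<Phi> \<circ> x) u" .
  show ?thesis
    unfolding unit_normal_def n using transition_det[OF x y wT] by simp
qed

text \<open>
  The choice of the chart is immaterial by \<open>unit_normal_transition\<close>.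
\<close>
definition gauss_map :: "'a \<Rightarrow> real^3" where
  "gauss_map p = (SOME n. \<exists>V x u. (V, x) \<in> \<A> \<and> u \<in> V \<and> p = x u \<and> n = unit_normal (\<Phi> \<circ> x) u)"

lemma gauss_map_chart:
  assumes "(V, x) \<in> \<A>" "u \<in> V"
  shows "gauss_map (x u) = unit_normal (\<Phi> \<circ> x) u"
proof -
  have "\<exists>n. \<exists>W y w. (W, y) \<in> \<A> \<and> w \<in> W \<and> x u = y w \<and> n = unit_normal (\<Phi> \<circ> y) w"
    using assms by blast
  from someI_ex[OF this] obtain W y w where y: "(W, y) \<in> \<A>" "w \<in> W" "x u = y w"
    "gauss_map (x u) = unit_normal (\<Phi> \<circ> y) w"
    unfolding gauss_map_def by blast
  show ?thesis
    unfolding y(4) by (rule unit_normal_transition[OF assms(1) y(1) assms(2) y(2,3)])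
qed

lemma constant_of_zero_derivative:
  fixes f :: "'a \<Rightarrow> 'b::real_normed_vector"
  assumes "connected (UNIV :: 'a set)"
    and zero: "\<And>V x u. (V, x) \<in> \<A> \<Longrightarrow> u \<in> V \<Longrightarrow> ((\<lambda>u. f (x u)) has_derivative (\<lambda>v. 0)) (at u)"
  shows "\<exists>a. \<forall>p. f p = a"
proof -
  have "\<exists>T. openin (top_of_set UNIV) T \<and> p \<in> T \<and> (\<forall>q\<in>T. f q = f p)" for p
  proof -
    obtain V x u where x: "(V, x) \<in> \<A>" "u \<in> V" "p = x u" by (rule chart_cover)
    obtain e where e: "e > 0" "ball u e \<subseteq> V"
      using open_chart_domain[OF x(1)] x(2) open_contains_ball by blast
    have "openin (top_of_set (x ` V)) (x ` ball u e)"
      using homeomorphism_imp_open_map[OF chart_homeomorphism[OF x(1)]] e(2)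
      by (simp add: openin_open_eq[OF open_chart_domain[OF x(1)]])
    then have "openin (top_of_set UNIV) (x ` ball u e)"
      using openin_open_eq[OF open_chart_image[OF x(1)]] by (simp add: subtopology_UNIV flip: open_openin)
    moreover have "p \<in> x ` ball u e" unfolding x(3) using e(1) by simp
    moreover have const: "f (x z) = f (x u)" if "z \<in> ball u e" for z
    proof -
      have "\<exists>c. \<forall>z\<in>ball u e. f (x z) = c"
        by (rule has_derivative_zero_constant[OF convex_ball
              has_derivative_at_withinI[OF zero[OF x(1) subsetD[OF e(2)]]]])
      then show ?thesis using that e(1) by (metis centre_in_ball)
    qed
    have "\<forall>q\<in>x ` ball u e. f q = f p" unfolding x(3) using const by blast
    ultimately show ?thesis by blast
  qed
  then have "f constant_on UNIV"
    by (intro locally_constant_imp_constant[OF assms(1)]) auto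
  then show ?thesis by (simp add: constant_on_def)
qed

end

theorem theorem1p3:
  fixes \<A> :: "'a::{t2_space, second_countable_topology} atlas"
    and \<Phi> :: "'a \<Rightarrow> real^3"
    and \<alpha> :: real
  assumes "\<alpha> \<noteq> 0"
    and "oriented_atlas \<A>"
    and "connected (UNIV :: 'a set)"
    and "smooth_immersion \<A> \<Phi>"
    and "0 \<notin> range \<Phi>"
    and "stationary \<A> \<alpha> \<Phi>"
    and "constant_mean_curvature \<A> \<Phi>"
  shows "(\<exists>n c. n \<noteq> 0 \<and> range \<Phi> \<subseteq> {y. n \<bullet> y = c}) \<or>
         (\<exists>c r. r > 0 \<and> range \<Phi> \<subseteq> sphere c r)"
proof -
  interpret immersed_surface \<A> \<Phi>
    using assms by unfold_locales
  obtain c where c: "\<And>V x u. (V, x) \<in> \<A> \<Longrightarrow> u \<in> V \<Longrightarrow> mean_curvature (\<Phi> \<circ> x) u = c"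
    using assms(7) unfolding constant_mean_curvature_def by blast
  have ne: "\<Phi> p \<noteq> 0" for p using assms(5) by (metis rangeI)
  have patch: "stationary_patch V (\<Phi> \<circ> x) c \<alpha>" if x: "(V, x) \<in> \<A>" for V x
  proof -
    interpret immersed_patch V "\<Phi> \<circ> x" by (rule immersed_patch[OF x])
    show ?thesis
      using euler_lagrange[OF assms(6,5) x] c[OF x] assms(1) ne by unfold_locales auto
  qed
  show ?thesis
  proof (cases "c + 4 * c / \<alpha> = 0")
    case False
    \<comment> \<open>The position vector is normal, so its length is constant.\<close>
    have zero: "((\<lambda>u. \<Phi> (x u) \<bullet> \<Phi> (x u)) has_derivative (\<lambda>v. 0)) (at u)"
      if x: "(V, x) \<in> \<A>" and u: "u \<in> V" for V x u
    proof -
      interpret stationary_patch V "\<Phi> \<circ> x" c \<alpha> by (rule patch[OF x])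
      have "\<partial> (\<lambda>u. (\<Phi> \<circ> x) u \<bullet> (\<Phi> \<circ> x) u) v u = 0" for v
        using deriv_norm_squared[OF u, of v] position_normal[OF _ u] False by (simp add: k_def)
      then show ?thesis
        using smooth_on_has_derivative[OF smooth_on_inner[OF open_V smooth smooth] u] by simp
    qed
    have "\<exists>a. \<forall>p. \<Phi> p \<bullet> \<Phi> p = a"
      by (rule constant_of_zero_derivative[OF assms(3)]) (rule zero)
    then obtain a where a: "\<And>p. \<Phi> p \<bullet> \<Phi> p = a" by auto
    then have "range \<Phi> \<subseteq> sphere 0 (sqrt a)" by (auto simp: norm_eq_sqrt_inner)
    moreover have "sqrt a > 0" using ne[of undefined] a[of undefined] by (metis inner_gt_zero_iff real_sqrt_gt_0_iff)
    ultimately show ?thesis by blast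
  next
    case True
    define \<kappa> where "\<kappa> = c + 2 * c / \<alpha>"
    have \<kappa>: "\<kappa> = c / 2" using True by (simp add: \<kappa>_def)
    have zero: "((\<lambda>u. gauss_map (x u) + \<kappa> *\<^sub>R \<Phi> (x u)) has_derivative (\<lambda>v. 0)) (at u)"
      if x: "(V, x) \<in> \<A>" and u: "u \<in> V" for V x u
    proof -
      interpret stationary_patch V "\<Phi> \<circ> x" c \<alpha> by (rule patch[OF x])
      have "((\<lambda>u. N u + \<kappa> *\<^sub>R (\<Phi> \<circ> x) u) has_derivative
          (\<lambda>v. \<partial> N v u + \<kappa> *\<^sub>R \<partial> (\<Phi> \<circ> x) v u)) (at u)"
        by (intro has_derivative_add has_derivative_scaleR_right
            smooth_on_has_derivative[OF smooth_N u] smooth_on_has_derivative[OF smooth u])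
      then have "((\<lambda>u. N u + \<kappa> *\<^sub>R (\<Phi> \<circ> x) u) has_derivative (\<lambda>v. 0)) (at u)"
        using umbilic[OF _ u] True by (simp add: \<kappa>_def \<kappa>\<^sub>2_def k_def)
      then show ?thesis
        by (rule has_derivative_transform_within_open[OF _ open_V u]) (simp add: gauss_map_chart[OF x])
    qed
    have "\<exists>a. \<forall>p. gauss_map p + \<kappa> *\<^sub>R \<Phi> p = a"
      by (rule constant_of_zero_derivative[OF assms(3)]) (rule zero)
    then obtain a where a: "\<And>p. gauss_map p + \<kappa> *\<^sub>R \<Phi> p = a" by auto
    have gauss: "gauss_map p \<bullet> gauss_map p = 1" "c * (\<Phi> p \<bullet> \<Phi> p) = \<alpha> * (\<Phi> p \<bullet> gauss_map p)" for p
    proof -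
      obtain V x u where x: "(V, x) \<in> \<A>" "u \<in> V" "p = x u" by (rule chart_cover)
      interpret stationary_patch V "\<Phi> \<circ> x" c \<alpha> by (rule patch[OF x(1)])
      show "gauss_map p \<bullet> gauss_map p = 1" "c * (\<Phi> p \<bullet> \<Phi> p) = \<alpha> * (\<Phi> p \<bullet> gauss_map p)"
        using inner_N_N[OF x(2)] stationary_eq[OF x(2)] by (simp_all add: x(3) gauss_map_chart[OF x(1,2)])
    qed
    show ?thesis
    proof (cases "c = 0")
      case True
      then have "gauss_map p = a" for p using a[of p] by (simp add: \<kappa>)
      then have "a \<noteq> 0" "a \<bullet> \<Phi> p = 0" for p
        using gauss[of p] True assms(1) by (auto simp: inner_commute)
      then show ?thesis by blast
    next
      case False
      have "\<Phi> p \<in> sphere ((1 / \<kappa>) *\<^sub>R a) (1 / \<bar>\<kappa>\<bar>)" for p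
      proof -
        have "(1 / \<kappa>) *\<^sub>R a - \<Phi> p = (1 / \<kappa>) *\<^sub>R gauss_map p"
          using a[of p] False by (simp add: \<kappa> scaleR_add_right flip: a[of p])
        then show ?thesis
          using gauss(1)[of p] by (simp add: dist_norm norm_eq_1)
      qed
      moreover have "1 / \<bar>\<kappa>\<bar> > 0" using False by (simp add: \<kappa>)
      ultimately show ?thesis by blast
    qed
  qed
qed

end
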